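(* For each integer $N\ge 2$ let $d_N=\frac{1}{\cos\frac{\pi}{4N}}$ and write $d_N^2=1+\varepsilon_N$. There exist constants $c_2>c_1>0$ and $N_0$ such that for every integer $N\ge N_0$ the maximum cardinality of a $d_N^2$-equilateral set in the planar (symmetric) Banach--Mazur compactum and the maximum cardinality of a $d_N^2$-separated set in the planar (symmetric) Banach--Mazur compactum both lie between $\exp\left(c_1\sqrt{\varepsilon_N^{-1}}\right)$ and $\exp\left(c_2\sqrt{\varepsilon_N^{-1}}\right)$.
   Context: A convex body in $\mathbb{R}^2$ is a compact convex set with non-empty interior; it is origin-symmetric if $K=-K$. For two origin-symmetric convex bodies $K,L\subseteq\mathbb{R}^2$ the Banach--Mazur distance is $$d_{BM}(K,L)=\inf\{r>0:\ K\subseteq T(L)\subseteq rK\},$$ where the infimum is taken over all $r>0$ and all invertible linear operators $T:\mathbb{R}^2\to\mathbb{R}^2$ satisfying the inclusions. It is a multiplicative distance, equal to $1$ exactly when $K$ and $L$ are linearly equivalent. The (symmetric) planar Banach--Mazur compactum is the set of linear equivalence classes of origin-symmetric convex bodies in $\mathbb{R}^2$ equipped with $d_{BM}$. A $d$-equilateral set is a set in which every two different elements are at distance exactly $d$. A $d$-separated set is a set in which every two different elements are at distance at least $d$. *)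

theory Defs
  imports "HOL-Analysis.Analysis"
begin

definition sym_convex_body :: "(real^2) set \<Rightarrow> bool" where
  "sym_convex_body K \<longleftrightarrow>
     compact K \<and> convex K \<and> interior K \<noteq> {} \<and> uminus ` K = K"

definition BM_dist :: "(real^2) set \<Rightarrow> (real^2) set \<Rightarrow> real" where
  "BM_dist K L =
     Inf {r. r > 0 \<and> (\<exists>T. linear T \<and> bij T \<and> K \<subseteq> T ` L \<and> T ` L \<subseteq> (*\<^sub>R) r ` K)}"

definition lin_equiv :: "((real^2) set \<times> (real^2) set) set" where
  "lin_equiv = {(K, L). sym_convex_body K \<and> sym_convex_body L \<and>
     (\<exists>T. linear T \<and> bij T \<and> L = T ` K)}"

definition BM_compactum :: "(real^2) set set set" where
  "BM_compactum = {K. sym_convex_body K} // lin_equiv"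

(* The set below is a singleton for classes X, Y: see BM_class_dist_eq. *)
definition BM_class_dist :: "(real^2) set set \<Rightarrow> (real^2) set set \<Rightarrow> real" where
  "BM_class_dist X Y = the_elem {BM_dist K L | K L. K \<in> X \<and> L \<in> Y}"

definition BM_equilateral :: "real \<Rightarrow> (real^2) set set set \<Rightarrow> bool" where
  "BM_equilateral d S \<longleftrightarrow>
     S \<subseteq> BM_compactum \<and> (\<forall>X\<in>S. \<forall>Y\<in>S. X \<noteq> Y \<longrightarrow> BM_class_dist X Y = d)"

definition BM_separated :: "real \<Rightarrow> (real^2) set set set \<Rightarrow> bool" where
  "BM_separated d S \<longleftrightarrow>
     S \<subseteq> BM_compactum \<and> (\<forall>X\<in>S. \<forall>Y\<in>S. X \<noteq> Y \<longrightarrow> BM_class_dist X Y \<ge> d)"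

(* Infinite sets have card 0, so finiteness of all competitors is stated explicitly. *)
definition is_max_card :: "('a set \<Rightarrow> bool) \<Rightarrow> nat \<Rightarrow> bool" where
  "is_max_card P m \<longleftrightarrow>
     (\<exists>S. P S \<and> finite S \<and> card S = m) \<and> (\<forall>S. P S \<longrightarrow> finite S \<and> card S \<le> m)"

definition d_N :: "nat \<Rightarrow> real" where
  "d_N N = 1 / cos (pi / (4 * real N))"

definition eps_N :: "nat \<Rightarrow> real" where
  "eps_N N = (d_N N)\<^sup>2 - 1"

lemma linear_bij_inv:
  fixes T :: "real^2 \<Rightarrow> real^2"
  assumes "linear T" "bij T"
  shows "linear (inv T)" "bij (inv T)" "inv T ` T ` K = K"
proof -
  show "linear (inv T)"
    using inj_linear_imp_inv_linear[OF assms(1) bij_is_inj[OF assms(2)]] .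
  show "bij (inv T)" using bij_imp_bij_inv[OF assms(2)] .
  show "inv T ` T ` K = K" using image_inv_f_f[OF bij_is_inj[OF assms(2)]] .
qed

lemma equiv_lin_equiv: "equiv {K. sym_convex_body K} lin_equiv"
proof (rule equivI)
  show "lin_equiv \<subseteq> {K. sym_convex_body K} \<times> {K. sym_convex_body K}"
    by (auto simp: lin_equiv_def)
  have "\<exists>T. linear T \<and> bij T \<and> K = T ` K" for K :: "(real^2) set"
    by (rule exI[of _ id]) (simp add: linear_id)
  then show "refl_on {K. sym_convex_body K} lin_equiv"
    by (simp add: refl_on_def lin_equiv_def)
  show "sym lin_equiv"
  proof (rule symI)
    fix K L :: "(real^2) set"
    assume "(K, L) \<in> lin_equiv"
    then obtain T where T: "sym_convex_body K" "sym_convex_body L" "linear T" "bij T" "L = T ` K"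
      by (auto simp: lin_equiv_def)
    have "linear (inv T)" "bij (inv T)" "K = inv T ` L"
      using linear_bij_inv[OF T(3,4)] T(5) by simp_all
    then show "(L, K) \<in> lin_equiv" using T(1,2) unfolding lin_equiv_def by blast
  qed
  show "trans lin_equiv"
  proof (rule transI)
    fix K L M :: "(real^2) set"
    assume "(K, L) \<in> lin_equiv" "(L, M) \<in> lin_equiv"
    then obtain S T where *: "sym_convex_body K" "sym_convex_body M"
      "linear S" "bij S" "L = S ` K" "linear T" "bij T" "M = T ` L"
      by (auto simp: lin_equiv_def)
    have "linear (T \<circ> S)" "bij (T \<circ> S)" "M = (T \<circ> S) ` K"
      using linear_compose[OF *(3,6)] bij_comp[OF *(4,7)] *(5,8) by (simp_all add: image_comp)
    then show "(K, M) \<in> lin_equiv" using *(1,2) unfolding lin_equiv_def by blast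
  qed
qed

lemma BM_dist_invariant_le:
  fixes K L K' L' :: "(real^2) set"
  assumes "(K, K') \<in> lin_equiv" "(L, L') \<in> lin_equiv"
    and "linear T" "bij T" "K \<subseteq> T ` L" "T ` L \<subseteq> (*\<^sub>R) r ` K"
  shows "\<exists>T. linear T \<and> bij T \<and> K' \<subseteq> T ` L' \<and> T ` L' \<subseteq> (*\<^sub>R) r ` K'"
proof -
  obtain S where S: "linear S" "bij S" "K' = S ` K" using assms by (auto simp: lin_equiv_def)
  obtain R where R: "linear R" "bij R" "L' = R ` L" using assms by (auto simp: lin_equiv_def)
  have iR: "linear (inv R)" "bij (inv R)" "inv R ` L' = L"
    using linear_bij_inv[OF R(1,2)] R(3) by simp_all
  let ?T = "S \<circ> T \<circ> inv R"
  have "?T ` L' = S ` (T ` L)"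
    by (simp only: image_comp[symmetric] iR(3))
  moreover have "S ` ((*\<^sub>R) r ` K) = (*\<^sub>R) r ` K'"
    using S by (simp add: image_image linear_cmul)
  ultimately have "K' \<subseteq> ?T ` L'" "?T ` L' \<subseteq> (*\<^sub>R) r ` K'"
    using image_mono[OF assms(5), of S] image_mono[OF assms(6), of S] S(3) by simp_all
  moreover have "linear ?T" "bij ?T"
    using linear_compose[OF iR(1) linear_compose[OF assms(3) S(1)]]
      bij_comp[OF iR(2) bij_comp[OF assms(4) S(2)]] by (simp_all add: comp_assoc)
  ultimately show ?thesis by blast
qed

lemma BM_dist_invariant:
  assumes "(K, K') \<in> lin_equiv" "(L, L') \<in> lin_equiv"
  shows "BM_dist K L = BM_dist K' L'"
proof -
  have "(K', K) \<in> lin_equiv" "(L', L) \<in> lin_equiv"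
    using assms equiv_lin_equiv by (meson equivE symE)+
  then have "(\<exists>T. linear T \<and> bij T \<and> K \<subseteq> T ` L \<and> T ` L \<subseteq> (*\<^sub>R) r ` K) \<longleftrightarrow>
      (\<exists>T. linear T \<and> bij T \<and> K' \<subseteq> T ` L' \<and> T ` L' \<subseteq> (*\<^sub>R) r ` K')" for r
    by (intro iffI; elim exE conjE)
      (erule (3) BM_dist_invariant_le[OF assms], erule (5) BM_dist_invariant_le)
  then show ?thesis
    by (simp only: BM_dist_def)
qed

lemma BM_class_dist_eq:
  assumes "X \<in> BM_compactum" "Y \<in> BM_compactum" "K \<in> X" "L \<in> Y"
  shows "BM_class_dist X Y = BM_dist K L"
proof -
  have "BM_dist K' L' = BM_dist K L" if "K' \<in> X" "L' \<in> Y" for K' L'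
  proof (rule BM_dist_invariant)
    show "(K', K) \<in> lin_equiv" "(L', L) \<in> lin_equiv"
      using assms that quotient_eq_iff[OF equiv_lin_equiv]
      unfolding BM_compactum_def by blast+
  qed
  then have "{BM_dist K' L' | K' L'. K' \<in> X \<and> L' \<in> Y} = {BM_dist K L}"
    using assms by blast
  then show ?thesis by (simp add: BM_class_dist_def)
qed

end

theory Submission
  imports Defs
begin

text \<open>
  Put \<open>x = pi / (4 N)\<close> and \<open>h = cos x\<close>, so that
  \<open>d_N = 1 / h\<close> and \<open>eps_N\<close> is the square of \<open>tan x\<close>; hence
  \<open>sqrt (1 / eps_N) = cot x\<close> lies between \<open>N\<close> and \<open>2 N\<close>,
  and both maxima have to be shown exponential in \<open>N\<close>.

  \<^emph>\<open>Lower bound.\<close> Cut caps off the unit disc by symmetric pairs of chords at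
  distance \<open>h\<close> from the origin, the pairs being indexed by a finite set of directions. Such
  a body lies between the discs of radius \<open>h\<close> and \<open>1\<close>, so any two are at
  distance at most \<open>1 / h\<^sup>2\<close> through a homothety. For the reverse inequality
  (\<open>spread_distance_ge\<close>) let \<open>T\<close> be linear with
  \<open>K \<subseteq> T L \<subseteq> r K\<close> and \<open>r < 1 / h\<^sup>2\<close>. Then
  \<open>T\<close> distorts the disc only by a factor \<open>1 / h^4\<close>, so on directions it acts
  almost as a rotation or a reflection. Let \<open>c\<close> be the quadratic mean of
  \<open>norm (T u)\<close> over unit vectors \<open>u\<close>. A chord of \<open>L\<close> in a
  direction where \<open>T\<close> stretches by at most \<open>c\<close>, landing at a place where
  \<open>K\<close> still has the full circular arc, forces \<open>c \<ge> 1 / h\<close>; a chord of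
  \<open>K\<close> in a direction where the adjoint stretches by at least \<open>c\<close>, pulled back
  to an intact arc of \<open>L\<close>, forces \<open>r \<ge> c / h\<close>. Together
  \<open>r \<ge> 1 / h\<^sup>2\<close>. Since \<open>norm (T u)\<^sup>2\<close> is
  \<open>c\<^sup>2\<close> plus a sinusoid in twice the angle of \<open>u\<close>, each of the two
  stretching conditions holds on a whole quadrant of the doubled angle. What is needed is thus
  combinatorial: an exponentially large family of chord patterns such that, after any rotation or
  reflection and in any quadrant, some chord of one pattern stays away from all chords of the other. A
  greedy choice works (\<open>exists_avoiding_family\<close>), because the patterns conflicting with a
  given one form an exponentially small fraction.

  \<^emph>\<open>Upper bound.\<close> In Auerbach position a body lies between the cross-polytope and
  the square, and its support function restricted to two lines is a pair of Lipschitz convex functions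
  on the unit interval. Convex functions that are Lipschitz can be approximated uniformly up to an error
  of order \<open>1 / n\<^sup>2\<close> by one of \<open>2 ^ O(n)\<close> candidates. The saving
  over the naive count comes from convexity: the rounded slopes along a grid are essentially increasing
  and are encoded by the set of their values; inside each grid interval the function is sampled with a
  fineness proportional to the growth of the slope, so that every further increment is known up to
  boundedly many choices, and the total number of samples is still \<open>O(n)\<close>
  (\<open>equal_codes_close\<close>). With \<open>n = 10 N\<close>, two bodies with the same code are
  closer than \<open>d_N\<^sup>2\<close> (\<open>separated_card_bound\<close>).
\<close>

section \<open>Chord patterns that avoid each other under all rotations and reflections\<close>

text \<open>
  The circle of directions is divided into \<open>36 g\<close> steps, grouped into \<open>4 g\<close>
  blocks of \<open>9\<close>. Each block carries one chord, at one of two positions \<open>3\<close>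
  apart, selected by one bit. Chords of different blocks of one pattern are then at least
  \<open>6\<close> apart, also cyclically.
\<close>
definition chord_pos :: "nat set \<Rightarrow> nat \<Rightarrow> int" where
  "chord_pos X k = 9 * int k + (if k \<in> X then 3 else 0)"

text \<open>
  The sign \<open>\<epsilon>\<close> distinguishes rotations from reflections of the cyclic grid. The
  tolerance of one step makes up for rounding an arbitrary rotation angle to the grid.
\<close>
definition hits :: "nat \<Rightarrow> int \<Rightarrow> int \<Rightarrow> int \<Rightarrow> int \<Rightarrow> bool" where
  "hits M \<epsilon> s i j \<longleftrightarrow> (\<exists>k. \<bar>i - \<epsilon> * j - s - k * int M\<bar> \<le> 1)"

text \<open>
  The blocks with \<open>k \<in> {q*g..<(q+1)*g}\<close> fill one of the four equal parts of the
  circle of directions; every sinusoid in the doubled angle is nonnegative on at least one of these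
  parts.
\<close>
definition avoids :: "nat \<Rightarrow> nat set \<Rightarrow> nat set \<Rightarrow> bool" where
  "avoids g X Y \<longleftrightarrow> (\<forall>q<4. \<forall>\<epsilon>\<in>{1,-1}. \<forall>s. \<exists>k\<in>{q*g..<(q+1)*g}. \<forall>l<4*g.
      \<not> hits (36*g) \<epsilon> s (chord_pos X k) (chord_pos Y l))"

text \<open>
  The gap of \<open>6\<close> persists across the end of the cycle because the largest position is
  \<open>36 g - 6\<close>.
\<close>
lemma chord_pos_close:
  assumes l: "l < 4*g" "l' < 4*g"
    and close: "\<bar>chord_pos X l - chord_pos Y l' + K * int (36*g)\<bar> \<le> 5"
  shows "l = l'" "K = 0"
proof -
  let ?d = "chord_pos X l - chord_pos Y l'"
  have d: "?d \<le> int (36*g) - 6" "?d \<ge> - (int (36*g) - 6)"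
    using l by (auto simp: chord_pos_def)
  show K: "K = 0"
  proof (rule ccontr)
    assume "K \<noteq> 0"
    then consider "K \<ge> 1" | "K \<le> -1" by linarith
    then show False
    proof cases
      case 1
      then have "K * int (36*g) \<ge> 1 * int (36*g)" by (intro mult_right_mono) auto
      then show False using d close by linarith
    next
      case 2
      then have "K * int (36*g) \<le> (-1) * int (36*g)" by (intro mult_right_mono) auto
      then show False using d close by linarith
    qed
  qed
  show "l = l'" using close K by (auto simp: chord_pos_def split: if_splits)
qed

lemma hits_shift: "hits M \<epsilon> s i j \<longleftrightarrow> hits M \<epsilon> (s mod int M) i j"
proof -
  define a b where "a = s mod int M" and "b = s div int M"
  have *: "s = a + b * int M" by (simp add: a_def b_def)
  have "hits M \<epsilon> s i j \<longleftrightarrow> hits M \<epsilon> a i j"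
  proof
    assume "hits M \<epsilon> s i j"
    then obtain k where "\<bar>i - \<epsilon> * j - s - k * int M\<bar> \<le> 1" unfolding hits_def by blast
    then have "\<bar>i - \<epsilon> * j - a - (k + b) * int M\<bar> \<le> 1"
      unfolding * by (simp add: algebra_simps)
    then show "hits M \<epsilon> a i j" unfolding hits_def by blast
  next
    assume "hits M \<epsilon> a i j"
    then obtain k where "\<bar>i - \<epsilon> * j - a - k * int M\<bar> \<le> 1" unfolding hits_def by blast
    then have "\<bar>i - \<epsilon> * j - s - (k - b) * int M\<bar> \<le> 1"
      unfolding * by (simp add: algebra_simps)
    then show "hits M \<epsilon> s i j" unfolding hits_def by blast
  qed
  then show ?thesis by (simp add: a_def)
qed

lemma card_fixed_on:
  assumes "S \<subseteq> Pow {..<n}" "C \<subseteq> {..<n::nat}"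
    and "\<And>X X'. X \<in> S \<Longrightarrow> X' \<in> S \<Longrightarrow> X \<inter> C = X' \<inter> C"
  shows "card S \<le> 2 ^ (n - card C)"
proof -
  have "inj_on (\<lambda>X. X - C) S"
  proof (rule inj_onI)
    fix X X' assume "X \<in> S" "X' \<in> S" "X - C = X' - C"
    then show "X = X'" using assms(3)[of X X'] by blast
  qed
  moreover have "(\<lambda>X. X - C) ` S \<subseteq> Pow ({..<n} - C)" using assms(1) by auto
  ultimately have "card S \<le> card (Pow ({..<n} - C))" by (intro card_inj_on_le) auto
  also have "\<dots> = 2 ^ (n - card C)"
    using assms(2) by (simp add: card_Pow card_Diff_subset finite_subset)
  finally show ?thesis .
qed

lemma abs_mult_sign:
  fixes p a m :: int
  assumes "\<epsilon> \<in> {1,-1}"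
  shows "\<bar>p + (\<epsilon> * a) * m\<bar> = \<bar>\<epsilon> * p + a * m\<bar>"
  using assms by auto

text \<open>
  If both bits of a block were possible, the two positions, \<open>3\<close> apart, would both be within
  \<open>1\<close> of images of chords of \<open>Y\<close>, giving chords of \<open>Y\<close> at
  distance between \<open>1\<close> and \<open>5\<close>. So the bit of each of the \<open>g\<close>
  blocks in the window is forced.
\<close>
lemma card_all_hit_from:
  assumes "q < 4" "\<epsilon> \<in> {1,-1::int}"
  shows "card {X \<in> Pow {..<4*g}. \<forall>k\<in>{q*g..<(q+1)*g}. \<exists>l<4*g.
            hits (36*g) \<epsilon> s (chord_pos X k) (chord_pos Y l)} \<le> 2 ^ (3*g)" (is "card ?S \<le> _")
proof -
  let ?C = "{q*g..<(q+1)*g}"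
  have C: "?C \<subseteq> {..<4*g}"
  proof
    fix k assume "k \<in> ?C"
    moreover have "(q+1)*g \<le> 4*g" using assms(1) by (intro mult_right_mono) auto
    ultimately show "k \<in> {..<4*g}" using less_le_trans[of k "(q+1)*g" "4*g"] by simp
  qed
  have False if X: "X \<in> ?S" "k \<in> X" and X': "X' \<in> ?S" "k \<notin> X'" and k: "k \<in> ?C" for X X' k
  proof -
    obtain l a where l: "l < 4*g" "\<bar>chord_pos X k - \<epsilon> * chord_pos Y l - s - a * int (36*g)\<bar> \<le> 1"
      using X(1) k unfolding hits_def by blast
    obtain l' a' where l': "l' < 4*g" "\<bar>chord_pos X' k - \<epsilon> * chord_pos Y l' - s - a' * int (36*g)\<bar> \<le> 1"
      using X'(1) k unfolding hits_def by blast
    let ?D = "\<epsilon> * (chord_pos Y l' - chord_pos Y l) + (a' - a) * int (36*g)"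
    have eq: "chord_pos X k = chord_pos X' k + 3" using X(2) X'(2) by (simp add: chord_pos_def)
    have D: "\<bar>3 + ?D\<bar> \<le> 2"
      using l(2) l'(2) unfolding eq by (simp add: algebra_simps)
    have "\<bar>chord_pos Y l' - chord_pos Y l + (\<epsilon> * (a' - a)) * int (36*g)\<bar> = \<bar>?D\<bar>"
      using assms(2) by (intro abs_mult_sign)
    also have "\<dots> \<le> 5" using D by linarith
    finally have "l' = l" "\<epsilon> * (a' - a) = 0" using chord_pos_close[OF l'(1) l(1)] by blast+
    then have "?D = 0" using assms(2) by auto
    then show False using D by simp
  qed
  then have sub: "X \<inter> ?C \<subseteq> X' \<inter> ?C" if "X \<in> ?S" "X' \<in> ?S" for X X'
    using that by (meson Int_iff subsetI)
  have "card ?S \<le> 2 ^ (4*g - card ?C)"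
  proof (rule card_fixed_on[OF _ C])
    show "X \<inter> ?C = X' \<inter> ?C" if "X \<in> ?S" "X' \<in> ?S" for X X'
      using sub[OF that] sub[OF that(2,1)] by (rule subset_antisym)
  qed (rule Collect_subset)
  then show ?thesis by simp
qed

text \<open>
  Here the chords of \<open>Y\<close> in the window have to hit chords of \<open>X\<close>. All
  available positions are at least \<open>3\<close> apart, so each chord of \<open>Y\<close> can hit
  only one of them and thereby fixes one bit of \<open>X\<close>; different chords of \<open>Y\<close>
  are \<open>6\<close> apart and fix bits of different blocks.
\<close>
lemma card_all_hit_into:
  assumes "q < 4" "\<epsilon> \<in> {1,-1::int}"
  shows "card {X \<in> Pow {..<4*g}. \<forall>k\<in>{q*g..<(q+1)*g}. \<exists>l<4*g.
            hits (36*g) \<epsilon> s (chord_pos Y k) (chord_pos X l)} \<le> 2 ^ (3*g)" (is "card ?S \<le> _")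
proof (cases "?S = {}")
  case True
  show ?thesis unfolding True by simp
next
  case False
  then obtain X0 where X0: "X0 \<in> ?S" by (meson all_not_in_conv)
  let ?W = "{q*g..<(q+1)*g}"
  have W: "k < 4*g" if "k \<in> ?W" for k
  proof -
    have "(q+1)*g \<le> 4*g" using assms(1) by (intro mult_right_mono) auto
    then show "k < 4*g" using that less_le_trans[of k "(q+1)*g" "4*g"] by simp
  qed
  have "\<forall>k\<in>?W. \<exists>l<4*g. hits (36*g) \<epsilon> s (chord_pos Y k) (chord_pos X0 l)"
    using X0 unfolding mem_Collect_eq by (rule conjunct2)
  then obtain l0 where l0: "\<And>k. k \<in> ?W \<Longrightarrow> l0 k < 4*g"
      "\<And>k. k \<in> ?W \<Longrightarrow> hits (36*g) \<epsilon> s (chord_pos Y k) (chord_pos X0 (l0 k))"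
    using bchoice[of ?W "\<lambda>k l. l < 4*g \<and> hits (36*g) \<epsilon> s (chord_pos Y k) (chord_pos X0 l)"]
    by blast
  have agree: "l = l' \<and> \<bar>chord_pos X l - chord_pos X' l'\<bar> \<le> 2"
    if hit: "hits (36*g) \<epsilon> s i (chord_pos X l)" "hits (36*g) \<epsilon> s i (chord_pos X' l')"
      and l: "l < 4*g" "l' < 4*g" for i X X' l l'
  proof -
    obtain a where a: "\<bar>i - \<epsilon> * chord_pos X l - s - a * int (36*g)\<bar> \<le> 1"
      using hit(1) unfolding hits_def by blast
    obtain a' where a': "\<bar>i - \<epsilon> * chord_pos X' l' - s - a' * int (36*g)\<bar> \<le> 1"
      using hit(2) unfolding hits_def by blast
    have "\<bar>chord_pos X l - chord_pos X' l' + (\<epsilon> * (a - a')) * int (36*g)\<bar>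
        = \<bar>\<epsilon> * (chord_pos X l - chord_pos X' l') + (a - a') * int (36*g)\<bar>"
      using assms(2) by (intro abs_mult_sign)
    also have "\<dots> \<le> 2" using a a' by (simp add: algebra_simps)
    finally have *: "\<bar>chord_pos X l - chord_pos X' l' + (\<epsilon> * (a - a')) * int (36*g)\<bar> \<le> 2" .
    then have eq: "l = l'" "\<epsilon> * (a - a') = 0"
      using chord_pos_close[OF l, of X X' "\<epsilon> * (a - a')"] by linarith+
    show ?thesis using *[unfolded eq(2)] eq(1) by simp
  qed
  have inj: "inj_on l0 ?W"
  proof (rule inj_onI)
    fix k k' assume k: "k \<in> ?W" "k' \<in> ?W" "l0 k = l0 k'"
    obtain a where a: "\<bar>chord_pos Y k - \<epsilon> * chord_pos X0 (l0 k) - s - a * int (36*g)\<bar> \<le> 1"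
      using l0(2)[OF k(1)] unfolding hits_def by blast
    obtain a' where a': "\<bar>chord_pos Y k' - \<epsilon> * chord_pos X0 (l0 k) - s - a' * int (36*g)\<bar> \<le> 1"
      using l0(2)[OF k(2)] k(3) unfolding hits_def by auto
    have "\<bar>chord_pos Y k - chord_pos Y k' + (a' - a) * int (36*g)\<bar> \<le> 5"
      using a a' by (simp add: algebra_simps)
    then show "k = k'" using chord_pos_close(1)[OF W[OF k(1)] W[OF k(2)]] by blast
  qed
  have fixed: "l0 k \<in> X \<longleftrightarrow> l0 k \<in> X0" if X: "X \<in> ?S" and k: "k \<in> ?W" for X k
  proof -
    obtain l where l: "l < 4*g" "hits (36*g) \<epsilon> s (chord_pos Y k) (chord_pos X l)"
      using X k by blast
    have *: "l = l0 k \<and> \<bar>chord_pos X l - chord_pos X0 (l0 k)\<bar> \<le> 2"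
      using agree[OF l(2) l0(2)[OF k] l(1) l0(1)[OF k]] .
    then have "\<bar>chord_pos X (l0 k) - chord_pos X0 (l0 k)\<bar> \<le> 2" by (elim conjE) (simp only:)
    then show ?thesis by (simp add: chord_pos_def split: if_splits)
  qed
  have "card ?S \<le> 2 ^ (4*g - card (l0 ` ?W))"
  proof (rule card_fixed_on)
    show "X \<inter> l0 ` ?W = X' \<inter> l0 ` ?W" if "X \<in> ?S" "X' \<in> ?S" for X X'
    proof -
      have *: "X \<inter> l0 ` ?W = X0 \<inter> l0 ` ?W" if "X \<in> ?S" for X
        using fixed[OF that] by blast
      show ?thesis unfolding *[OF that(1)] *[OF that(2)] by (rule refl)
    qed
    show "l0 ` ?W \<subseteq> {..<4*g}" using l0(1) by blast
  qed (rule Collect_subset)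
  moreover have "4*g - card (l0 ` ?W) = 3*g" by (subst card_image[OF inj]) simp
  ultimately show ?thesis by (simp only:)
qed

text \<open>
  Union bound over \<open>4\<close> windows, rotations and reflections, and \<open>36 g\<close> shifts,
  for each of the two roles of \<open>Y\<close>.
\<close>
lemma card_bad:
  assumes "g > 0"
  shows "card {X \<in> Pow {..<4*g}. \<not> avoids g X Y \<or> \<not> avoids g Y X} \<le> 576 * g * 2 ^ (3*g)"
    (is "card ?B \<le> _")
proof -
  define I where "I = {..<4::nat} \<times> {1,-1::int} \<times> {0..<36 * int g}"
  define H where "H = (\<lambda>X Z q \<epsilon> s. \<forall>k\<in>{q*g..<(q+1)*g}. \<exists>l<4*g.
            hits (36*g) \<epsilon> s (chord_pos X k) (chord_pos Z l))"
  define S where "S = (\<lambda>(q,\<epsilon>,s). {X \<in> Pow {..<4*g}. H X Y q \<epsilon> s})"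
  define S' where "S' = (\<lambda>(q,\<epsilon>,s). {X \<in> Pow {..<4*g}. H Y X q \<epsilon> s})"
  have finI: "finite I" and cardI: "card I = 288 * g"
    unfolding I_def by (auto simp: card_cartesian_product)
  have red: "\<exists>q \<epsilon> s. (q,\<epsilon>,s) \<in> I \<and> H X Z q \<epsilon> s" if bad: "\<not> avoids g X Z" for X Z
  proof -
    have "\<exists>q<4. \<exists>\<epsilon>\<in>{1,-1}. \<exists>s. H X Z q \<epsilon> s"
      using bad unfolding avoids_def H_def by (simp only: not_all not_imp not_not bex_simps ball_simps) blast
    then obtain q \<epsilon> s where *: "q < 4" "\<epsilon> \<in> {1,-1}" "H X Z q \<epsilon> s" by blast
    have "H X Z q \<epsilon> (s mod int (36*g))"
      using *(3) unfolding H_def by (simp only: hits_shift[symmetric])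
    moreover have "(q, \<epsilon>, s mod int (36*g)) \<in> I" using *(1,2) assms by (simp add: I_def)
    ultimately show ?thesis by blast
  qed
  have "?B \<subseteq> (\<Union>i\<in>I. S i) \<union> (\<Union>i\<in>I. S' i)"
  proof
    fix X assume X: "X \<in> ?B"
    then consider "\<not> avoids g X Y" | "\<not> avoids g Y X" by blast
    then show "X \<in> (\<Union>i\<in>I. S i) \<union> (\<Union>i\<in>I. S' i)"
    proof cases
      case 1
      obtain q \<epsilon> s where *: "(q,\<epsilon>,s) \<in> I" "H X Y q \<epsilon> s" using red[OF 1] by blast
      then have "X \<in> S (q,\<epsilon>,s)" using X by (simp add: S_def)
      then show ?thesis using *(1) by blast
    next
      case 2
      obtain q \<epsilon> s where *: "(q,\<epsilon>,s) \<in> I" "H Y X q \<epsilon> s" using red[OF 2] by blast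
      then have "X \<in> S' (q,\<epsilon>,s)" using X by (simp add: S'_def)
      then show ?thesis using *(1) by blast
    qed
  qed
  moreover have "finite (S i)" "finite (S' i)" for i
    by (auto simp: S_def S'_def split: prod.split)
  ultimately have "card ?B \<le> card ((\<Union>i\<in>I. S i) \<union> (\<Union>i\<in>I. S' i))"
    using finI by (intro card_mono) auto
  also have "\<dots> \<le> card (\<Union>i\<in>I. S i) + card (\<Union>i\<in>I. S' i)" by (rule card_Un_le)
  also have "\<dots> \<le> (\<Sum>i\<in>I. card (S i)) + (\<Sum>i\<in>I. card (S' i))"
    using finI by (intro add_mono card_UN_le)
  also have "\<dots> \<le> (\<Sum>i\<in>I. 2 ^ (3*g)) + (\<Sum>i\<in>I. 2 ^ (3*g))"
  proof (intro add_mono sum_mono)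
    fix i assume "i \<in> I"
    then obtain q \<epsilon> s where qes: "i = (q,\<epsilon>,s)" "q < 4" "\<epsilon> \<in> {1,-1}" unfolding I_def by blast
    show "card (S i) \<le> 2 ^ (3*g)"
      using card_all_hit_from[OF qes(2,3)] unfolding qes(1) S_def H_def prod.case .
    show "card (S' i) \<le> 2 ^ (3*g)"
      using card_all_hit_into[OF qes(2,3)] unfolding qes(1) S'_def H_def prod.case .
  qed
  also have "\<dots> = 576 * g * 2 ^ (3*g)" by (simp add: cardI)
  finally show ?thesis .
qed

text \<open>
  Gilbert--Varshamov argument: by maximality of the family every pattern belongs to it or conflicts with
  one of its members, and \<open>card_bad\<close> bounds the number of conflicts per member.
\<close>
lemma exists_avoiding_family:
  assumes "g > 0"
  shows "\<exists>F. F \<subseteq> Pow {..<4*g} \<and> 2 ^ g \<le> card F * (577 * g) \<and>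
    (\<forall>X\<in>F. \<forall>Y\<in>F. X \<noteq> Y \<longrightarrow> avoids g X Y)"
proof -
  define U where "U = Pow {..<4*g}"
  define ok where "ok = (\<lambda>F. F \<subseteq> U \<and> (\<forall>X\<in>F. \<forall>Y\<in>F. X \<noteq> Y \<longrightarrow> avoids g X Y))"
  define bad where "bad = (\<lambda>Y. {X \<in> U. \<not> avoids g X Y \<or> \<not> avoids g Y X})"
  have finU: "finite U" by (simp add: U_def)
  have fin: "finite (Collect ok)"
    by (rule finite_subset[of _ "Pow U"]) (auto simp: ok_def finU)
  have ne: "Collect ok \<noteq> {}" by (auto simp: ok_def)
  obtain F where F: "ok F" "\<And>F'. ok F' \<Longrightarrow> F \<subseteq> F' \<Longrightarrow> F = F'"
    using finite_has_maximal[OF fin ne] by blast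
  have FU: "F \<subseteq> U" using F(1) by (simp add: ok_def)
  have finF: "finite F" using FU finU by (rule finite_subset)
  have finbad: "finite (bad Y)" for Y using finU by (simp add: bad_def)
  have "U \<subseteq> F \<union> (\<Union>Y\<in>F. bad Y)"
  proof
    fix X assume X: "X \<in> U"
    show "X \<in> F \<union> (\<Union>Y\<in>F. bad Y)"
    proof (rule ccontr)
      assume no: "X \<notin> F \<union> (\<Union>Y\<in>F. bad Y)"
      then have "avoids g X Y \<and> avoids g Y X" if "Y \<in> F" for Y
        using X that by (auto simp: bad_def)
      then have "ok (insert X F)" using F(1) X by (simp add: ok_def)
      then have "F = insert X F" by (rule F(2)) blast
      then show False using no by blast
    qed
  qed
  then have "card U \<le> card (F \<union> (\<Union>Y\<in>F. bad Y))"
    using finF finbad by (intro card_mono) simp_all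
  also have "\<dots> \<le> card F + card (\<Union>Y\<in>F. bad Y)" by (rule card_Un_le)
  also have "\<dots> \<le> card F + (\<Sum>Y\<in>F. card (bad Y))"
    using finF by (intro add_left_mono card_UN_le)
  also have "\<dots> \<le> card F + (\<Sum>Y\<in>F. 576 * g * 2 ^ (3*g))"
    unfolding bad_def U_def by (intro add_left_mono sum_mono card_bad assms)
  also have "\<dots> = card F * (1 + 576 * g * 2 ^ (3*g))" by simp
  also have "\<dots> \<le> card F * (577 * g * 2 ^ (3*g))"
  proof -
    define p :: nat where "p = 2 ^ (3*g)"
    have "1 * 1 \<le> g * p" using assms by (intro mult_le_mono) (auto simp: p_def)
    then have "1 + 576 * g * p \<le> 577 * g * p" by linarith
    then show ?thesis unfolding p_def by (rule mult_le_mono2)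
  qed
  finally have le: "card U \<le> card F * (577 * g * 2 ^ (3*g))" .
  have "4 * g = g + 3 * g" by simp
  then have "card U = 2 ^ g * 2 ^ (3*g)"
    unfolding U_def by (simp only: card_Pow finite_lessThan card_lessThan power_add)
  with le have "2 ^ g * 2 ^ (3*g) \<le> card F * (577 * g) * 2 ^ (3*g)"
    by (simp only: mult.assoc)
  then have "2 ^ g \<le> card F * (577 * g)" by (simp only: mult_le_cancel2) simp
  with F(1) show ?thesis unfolding ok_def U_def by (intro exI[of _ F]) blast
qed

section \<open>Encoding convex functions by boundedly many bits per grid interval\<close>

text \<open>
  A Lipschitz convex function, to be approximated on the unit interval, with argument scaled by
  \<open>n\<close> and values scaled by \<open>n\<^sup>2\<close>: the grid becomes the integers and the
  wanted precision a constant. The slopes then vary over a range of length \<open>O(n)\<close>, that is,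
  by a bounded amount per grid interval on average.
\<close>
locale steep_convex =
  fixes n :: nat and V :: "real \<Rightarrow> real"
  assumes pos: "n > 0"
    and conv: "convex_on UNIV V"
    and lip: "\<bar>V x - V y\<bar> \<le> 2 * real n * \<bar>x - y\<bar>"
    and V0: "V 0 = (real n)\<^sup>2"
begin

definition slope :: "int \<Rightarrow> int" where
  "slope j = \<lfloor>V (real_of_int (j + 1))\<rfloor> - \<lfloor>V (real_of_int j)\<rfloor>"

text \<open>
  By convexity the slope of \<open>V\<close> on \<open>{j..j + 1}\<close> stays between those of the
  two neighbouring intervals. The number of cells exceeds this variation, so the slope times the length
  of a cell varies by at most \<open>1\<close>. The constant \<open>4\<close> absorbs the rounding
  errors and keeps the number at least \<open>2\<close>.
\<close>
definition cells :: "int \<Rightarrow> int" where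
  "cells j = slope (j + 1) - slope (j - 1) + 4"

text \<open>
  The cumulated number of cells, up to a constant: the defining sum of second differences of
  \<open>slope\<close> telescopes. This makes it evident that all cells together number only
  \<open>O(n)\<close>.
\<close>
definition offset :: "int \<Rightarrow> int" where
  "offset j = slope j + slope (j - 1) + 4 * j"

definition node :: "int \<Rightarrow> int \<Rightarrow> real" where
  "node j a = j + a / cells j"

text \<open>
  The prediction subtracted here is computable from the slopes alone, so a bounded correction suffices
  to continue the rounded values from node to node.
\<close>
definition digit :: "int \<Rightarrow> int \<Rightarrow> int" where
  "digit j a = \<lfloor>V (node j (a + 1))\<rfloor> - \<lfloor>V (node j a)\<rfloor> - slope (j - 1) div cells j"

text \<open>
  Rounding spoils the monotonicity of the slopes by at most \<open>1\<close>; adding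
  \<open>2 * j\<close> makes the sequence strictly increasing, so the set of its values determines it.
\<close>
definition coarse_code :: "int set" where
  "coarse_code = (\<lambda>j. slope j + 2 * j) ` {-1..int n + 1}"

text \<open>
  The digits are labelled by the flat index \<open>offset j + a\<close> instead of
  \<open>(j, a)\<close>, which keeps the ambient set of size \<open>O(n)\<close>.
\<close>
definition fine_code :: "(int \<times> int) set" where
  "fine_code = (\<lambda>(j, a). (offset j + a, digit j a)) ` {(j, a). 0 \<le> j \<and> j \<le> int n \<and> 0 \<le> a \<and> a < cells j}"

lemma slope_approx:
  "\<bar>real_of_int (slope j) - (V (real_of_int j + 1) - V (real_of_int j))\<bar> < 1"
  unfolding slope_def by (simp add: abs_less_iff) linarith

lemma three_slopes:
  assumes "x < y" "y \<le> z" "z < w"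
  shows "(V y - V x) / (y - x) \<le> (V w - V z) / (w - z)"
proof -
  have *: "(V b - V a) / (b - a) \<le> (V c - V b) / (c - b)" if "a < b" "b < c" for a b c
    using convex_on_slope_le[OF conv, of a c b] that by (simp add: field_simps) 
  show ?thesis
  proof (cases "y = z")
    case True
    then show ?thesis using * assms by blast
  next
    case False
    then have "(V y - V x) / (y - x) \<le> (V z - V y) / (z - y)" "(V z - V y) / (z - y) \<le> (V w - V z) / (w - z)"
      using * assms by auto
    then show ?thesis by linarith
  qed
qed

lemma slope_step: "slope j \<ge> slope (j - 1) - 1"
proof -
  have "V (real_of_int j) - V (real_of_int j - 1) \<le> V (real_of_int j + 1) - V (real_of_int j)"
    using three_slopes[of "real_of_int j - 1" j j "real_of_int j + 1"] by simp
  then show ?thesis using slope_approx[of j] slope_approx[of "j - 1"]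
    by (simp add: abs_less_iff)
qed

lemma cells_ge: "cells j \<ge> 2"
  using slope_step[of j] slope_step[of "j + 1"] by (simp add: cells_def)

lemma slope_bound: "\<bar>slope j\<bar> \<le> 2 * int n"
proof -
  have "\<bar>V (real_of_int j + 1) - V (real_of_int j)\<bar> \<le> 2 * real n"
    using lip[of "real_of_int j + 1" j] by simp
  then have "\<bar>real_of_int (slope j)\<bar> < 2 * real n + 1" using slope_approx[of j] by linarith
  then have "real_of_int \<bar>slope j\<bar> < real_of_int (2 * int n + 1)" by simp
  then show ?thesis by (simp only: of_int_less_iff)
qed

lemma offset_step: "offset (j + 1) = offset j + cells j"
  by (simp add: offset_def cells_def)

lemma offset_mono:
  assumes "j \<le> j'" shows "offset j \<le> offset j'"
  using assms
proof (induction rule: int_ge_induct)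
  case (step i)
  then show ?case using offset_step[of i] cells_ge[of i] by linarith
qed simp

lemma flat_index_inj:
  assumes "0 \<le> a" "a < cells j" "0 \<le> a'" "a' < cells j'" "offset j + a = offset j' + a'"
  shows "j = j' \<and> a = a'"
proof -
  have "\<not> j < j'" 
    using assms offset_mono[of "j + 1" j'] offset_step[of j] by linarith
  moreover have "\<not> j' < j" 
    using assms offset_mono[of "j' + 1" j] offset_step[of j'] by linarith
  ultimately have "j = j'" by simp
  then show ?thesis using assms by simp
qed

lemma coarse_code_subset: "coarse_code \<subseteq> {- 2 * int n - 2..4 * int n + 2}"
proof
  fix t assume "t \<in> coarse_code"
  then obtain j where "t = slope j + 2 * j" "j \<ge> -1" "j \<le> int n + 1" 
    unfolding coarse_code_def by auto
  then show "t \<in> {- 2 * int n - 2..4 * int n + 2}" using slope_bound[of j] by auto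
qed

lemma increment_bounds:
  fixes x y :: real
  assumes "j \<le> x" "x < y" "y \<le> j + 1"
  shows "(slope (j - 1) - 1) * (y - x) \<le> V y - V x" "V y - V x \<le> (slope (j + 1) + 1) * (y - x)"
proof -
  have "V j - V (real_of_int j - 1) \<le> (V y - V x) / (y - x)"
    using three_slopes[of "real_of_int j - 1" j x y] assms by simp
  moreover have "slope (j - 1) - 1 \<le> V j - V (real_of_int j - 1)"
    using slope_approx[of "j - 1"] by simp
  ultimately have "slope (j - 1) - 1 \<le> (V y - V x) / (y - x)" by linarith
  then show "(slope (j - 1) - 1) * (y - x) \<le> V y - V x"
    using assms by (simp add: pos_le_divide_eq)
  have "(V y - V x) / (y - x) \<le> V (real_of_int j + 2) - V (real_of_int j + 1)"
    using three_slopes[of x y "real_of_int j + 1" "real_of_int j + 2"] assms by simp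
  moreover have "V (real_of_int j + 2) - V (real_of_int j + 1) \<le> slope (j + 1) + 1"
    using slope_approx[of "j + 1"] by (simp add: add.assoc abs_less_iff)
  ultimately have "(V y - V x) / (y - x) \<le> slope (j + 1) + 1" by linarith
  then show "V y - V x \<le> (slope (j + 1) + 1) * (y - x)"
    using assms by (simp add: pos_divide_le_eq)
qed

text \<open>
  The increment over a cell of length \<open>1 / cells j\<close> lies in an interval of length below
  \<open>1\<close> that begins near the slope of the preceding grid interval divided by
  \<open>cells j\<close>; the remaining range accounts for the roundings.
\<close>
lemma digit_bounds:
  assumes "0 \<le> a" "a < cells j"
  shows "digit j a \<in> {-2..4}"
proof -
  let ?K = "real_of_int (cells j)" and ?s = "real_of_int (slope (j - 1))"
  have K: "?K \<ge> 2" using cells_ge[of j] by simp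
  have step: "node j (a + 1) - node j a = 1 / ?K" by (simp add: node_def add_divide_distrib)
  have "real_of_int (a + 1) \<le> ?K" using assms by linarith
  then have "real_of_int (a + 1) / ?K \<le> 1" using K by (simp add: divide_le_eq)
  then have range: "j \<le> node j a" "node j a < node j (a + 1)" "node j (a + 1) \<le> real_of_int j + 1"
    using assms K step unfolding node_def by (auto simp: field_simps)
  have lo: "(?s - 1) / ?K \<le> V (node j (a + 1)) - V (node j a)"
    using increment_bounds(1)[OF range] unfolding step by simp
  have "V (node j (a + 1)) - V (node j a) \<le> (slope (j + 1) + 1) / ?K"
    using increment_bounds(2)[OF range] unfolding step by simp
  also have "real_of_int (slope (j + 1) + 1) = ?s + ?K - 3"
    by (simp add: cells_def)
  also have "(?s + ?K - 3) / ?K \<le> ?s / ?K + 1"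
    using K by (simp add: field_simps)
  finally have hi: "V (node j (a + 1)) - V (node j a) \<le> ?s / ?K + 1" .
  have "?s / ?K - 1 \<le> (?s - 1) / ?K" using K by (simp add: field_simps)
  then have lo': "?s / ?K - 1 \<le> V (node j (a + 1)) - V (node j a)" using lo by linarith
  have fl: "slope (j - 1) div cells j = \<lfloor>?s / ?K\<rfloor>" by (rule floor_divide_of_int_eq[symmetric])
  show ?thesis using lo' hi unfolding digit_def fl by simp linarith
qed

lemma fine_code_subset: "fine_code \<subseteq> {- 4 * int n..12 * int n + 4} \<times> {-2..4}"
proof
  fix t assume "t \<in> fine_code"
  then obtain j a where t: "t = (offset j + a, digit j a)" and ja: "0 \<le> j" "j \<le> int n" "0 \<le> a" "a < cells j"
    unfolding fine_code_def by auto
  have "offset j \<ge> - 4 * int n" using slope_bound[of j] slope_bound[of "j - 1"] ja by (simp add: offset_def)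
  moreover have "offset j + a \<le> 12 * int n + 4"
  proof -
    have "offset j + a \<le> offset (j + 1)" using offset_step[of j] ja by linarith
    also have "\<dots> \<le> 8 * int n + 4"
      using slope_bound[of "j + 1"] slope_bound[of j] ja by (simp add: offset_def)
    finally show ?thesis by simp
  qed
  ultimately show "t \<in> {- 4 * int n..12 * int n + 4} \<times> {-2..4}"
    using digit_bounds[of a j] ja t by simp
qed

end

text \<open>
  At the first index where the two sequences differ, the smaller of the two values would be missed by
  the other sequence.
\<close>
lemma strict_mono_int_image_eq:
  fixes f g :: "int \<Rightarrow> int"
  assumes f: "\<And>j. f j < f (j + 1)" and g: "\<And>j. g j < g (j + 1)"
    and img: "f ` {a..b} = g ` {a..b}" and j: "a \<le> j" "j \<le> b"
  shows "f j = g j"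
proof -
  have mono: "h i < h k \<longleftrightarrow> i < k" if h: "\<And>j. h j < h (j + 1)" for h :: "int \<Rightarrow> int" and i k
  proof -
    have less: "h i < h k" if "i < k" for i k
      using that
    proof (induction rule: int_gr_induct)
      case base then show ?case using h .
    next
      case (step i) then show ?case using h[of i] by linarith
    qed
    then show ?thesis by (metis not_less_iff_gr_or_eq)
  qed
  have not_less: "\<not> f1 j < g1 j"
    if f1: "\<And>j. f1 j < f1 (j + 1)" and g1: "\<And>j. g1 j < g1 (j + 1)"
      and sub: "f1 ` {a..b} \<subseteq> g1 ` {a..b}" and j: "a \<le> j" "j \<le> b"
      and below: "\<And>k. a \<le> k \<Longrightarrow> k < j \<Longrightarrow> f1 k = g1 k" for f1 g1 :: "int \<Rightarrow> int" and j
  proof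
    assume less: "f1 j < g1 j"
    have "f1 j \<in> g1 ` {a..b}" using sub j by auto
    then obtain k where k: "a \<le> k" "k \<le> b" "f1 j = g1 k" by auto
    have "k < j" using less k(3) mono[of g1 k j] g1 by simp
    then have "f1 k = f1 j" using below[of k] k by simp
    then show False using mono[of f1 k j] f1 \<open>k < j\<close> by simp
  qed
  show ?thesis using j
  proof (induction "nat (j - a)" arbitrary: j rule: less_induct)
    case less
    then have below: "f k = g k" if "a \<le> k" "k < j" for k
      using that by simp
    show ?case
      using not_less[of f g j] not_less[of g f j] f g img less.prems below by force
  qed
qed

text \<open>
  The coarse code determines the slopes, hence all cells, and then the digits determine the rounded
  values at all nodes. Between a node and the next one both functions follow the same line up to an
  error of \<open>1\<close>, the slope being confined to an interval shorter than
  \<open>cells j\<close>.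
\<close>
lemma equal_codes_close:
  assumes "steep_convex n V" "steep_convex n W"
    and coarse: "steep_convex.coarse_code n V = steep_convex.coarse_code n W"
    and fine: "steep_convex.fine_code n V = steep_convex.fine_code n W"
    and x: "0 \<le> x" "x \<le> real n"
  shows "\<bar>V x - W x\<bar> \<le> 2"
proof -
  interpret V: steep_convex n V by fact
  interpret W: steep_convex n W by fact
  have slope: "V.slope j = W.slope j" if "-1 \<le> j" "j \<le> int n + 1" for j
  proof -
    have "V.slope j + 2 * j = W.slope j + 2 * j"
    proof (rule strict_mono_int_image_eq[of "\<lambda>j. V.slope j + 2 * j" "\<lambda>j. W.slope j + 2 * j" "-1" "int n + 1"])
      show "V.slope j + 2 * j < V.slope (j + 1) + 2 * (j + 1)" for j
        using V.slope_step[of "j + 1"] by simp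
      show "W.slope j + 2 * j < W.slope (j + 1) + 2 * (j + 1)" for j
        using W.slope_step[of "j + 1"] by simp
      show "(\<lambda>j. V.slope j + 2 * j) ` {- 1..int n + 1} = (\<lambda>j. W.slope j + 2 * j) ` {- 1..int n + 1}"
        using coarse unfolding V.coarse_code_def W.coarse_code_def .
    qed (use that in auto)
    then show ?thesis by simp
  qed
  have cells: "V.cells j = W.cells j" if "0 \<le> j" "j \<le> int n" for j
    using slope[of "j + 1"] slope[of "j - 1"] that by (simp add: V.cells_def W.cells_def)
  have offset: "V.offset j = W.offset j" if "0 \<le> j" "j \<le> int n" for j
    using slope[of j] slope[of "j - 1"] that by (simp add: V.offset_def W.offset_def)
  have node: "V.node j a = W.node j a" if "0 \<le> j" "j \<le> int n" for j a
    using cells[OF that] by (simp add: V.node_def W.node_def)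
  have digit: "V.digit j a = W.digit j a" if "0 \<le> j" "j \<le> int n" "0 \<le> a" "a < V.cells j" for j a
  proof -
    have "(V.offset j + a, V.digit j a) \<in> V.fine_code" using that unfolding V.fine_code_def by auto
    then obtain j' a' where *: "V.offset j + a = W.offset j' + a'" "V.digit j a = W.digit j' a'"
      "0 \<le> j'" "j' \<le> int n" "0 \<le> a'" "a' < W.cells j'"
      unfolding fine W.fine_code_def by auto
    have "a' < V.cells j'" "V.offset j + a = V.offset j' + a'"
      using *(1,6) cells[OF *(3,4)] offset[OF *(3,4)] by simp_all
    then have "j = j' \<and> a = a'"
      by (rule V.flat_index_inj[OF that(3,4) *(5)])
    then show ?thesis using *(2) by simp
  qed
  have grid: "\<lfloor>V (real_of_int j)\<rfloor> = \<lfloor>W (real_of_int j)\<rfloor>" if "0 \<le> j" "j \<le> int n" for j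
    using that
  proof (induction rule: int_ge_induct)
    case base
    then show ?case using V.V0 W.V0 by simp
  next
    case (step j)
    then show ?case using slope[of j] by (simp add: V.slope_def W.slope_def)
  qed
  have nodes: "\<lfloor>V (V.node j a)\<rfloor> = \<lfloor>W (V.node j a)\<rfloor>"
    if j: "0 \<le> j" "j \<le> int n" and a: "0 \<le> a" "a \<le> V.cells j" for j a
    using a
  proof (induction rule: int_ge_induct)
    case base
    then show ?case using grid[OF j] by (simp add: V.node_def)
  next
    case (step a)
    have "V.digit j a = W.digit j a" using digit[OF j] step by simp
    then show ?case using step slope[of "j - 1"] j cells[OF j] node[OF j]
      by (simp add: V.digit_def W.digit_def)
  qed
  \<comment> \<open>\<open>V.node j a\<close> is the last node not exceeding \<open>x\<close>.\<close>
  define j a where "j = \<lfloor>x\<rfloor>" and "a = \<lfloor>(x - j) * V.cells j\<rfloor>"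
  have j: "0 \<le> j" "j \<le> int n" using x by (auto simp: j_def le_floor_iff floor_le_iff)
  have K: "real_of_int (V.cells j) \<ge> 2" using V.cells_ge[of j] by simp
  have jx: "j \<le> x" "x < j + 1" by (simp_all add: j_def)
  have "(x - j) * V.cells j < 1 * real_of_int (V.cells j)"
    using jx K by (intro mult_strict_right_mono) auto
  then have a: "0 \<le> a" "a < V.cells j"
    using jx K by (auto simp: a_def le_floor_iff floor_less_iff)
  have "a \<le> (x - j) * V.cells j" "(x - j) * V.cells j < a + 1"
    by (simp_all add: a_def)
  then have nx: "V.node j a \<le> x" "x \<le> V.node j a + 1 / V.cells j"
    using K by (simp_all add: V.node_def field_simps)
  have "\<bar>V (V.node j a) - W (V.node j a)\<bar> < 1"
    using nodes[OF j a(1)] a(2) by (simp add: abs_less_iff) linarith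
  moreover have "\<bar>(V x - V (V.node j a)) - (W x - W (V.node j a))\<bar> \<le> 1"
  proof (cases "V.node j a = x")
    case False
    let ?h = "x - V.node j a"
    have h: "?h > 0" "?h * V.cells j \<le> 1" using nx False K by (auto simp: field_simps)
    have jn: "j \<le> V.node j a" using a K by (simp add: V.node_def)
    have eq: "W.slope (j - 1) = V.slope (j - 1)" "W.slope (j + 1) = V.slope (j + 1)"
      using slope[of "j - 1"] slope[of "j + 1"] j by auto
    note bV = V.increment_bounds[of j "V.node j a" x, OF jn] 
    note bW = W.increment_bounds[of j "V.node j a" x, OF jn, unfolded eq]
    have "(V.slope (j + 1) + 1) * ?h - (V.slope (j - 1) - 1) * ?h = (V.cells j - 2) * ?h"
      by (simp add: V.cells_def algebra_simps)
    also have "\<dots> \<le> 1" using h by (simp add: algebra_simps)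
    finally show ?thesis using bV bW h(1) jx by (simp add: abs_le_iff)
  qed simp
  ultimately show ?thesis by linarith
qed

section \<open>Auerbach position, support functions and the count of separated bodies\<close>

lemma inner_real2: "(x::real^2) \<bullet> y = x$1 * y$1 + x$2 * y$2"
  by (simp add: inner_vec_def sum_2)

lemma vec2_eq_iff: "(x::real^2) = y \<longleftrightarrow> x$1 = y$1 \<and> x$2 = y$2"
  by (simp add: vec_eq_iff forall_2)

definition auerbach_position :: "(real^2) set \<Rightarrow> bool" where
  "auerbach_position K \<longleftrightarrow> sym_convex_body K \<and> vector [1,0] \<in> K \<and> vector [0,1] \<in> K \<and>
     (\<forall>x\<in>K. \<bar>x$1\<bar> \<le> 1 \<and> \<bar>x$2\<bar> \<le> 1)"

lemma sym_convex_body_uminus: "sym_convex_body K \<Longrightarrow> x \<in> K \<Longrightarrow> - x \<in> K"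
  unfolding sym_convex_body_def by (metis image_eqI)

lemma sym_convex_body_linear_image:
  assumes "sym_convex_body K" "linear T" "bij T"
  shows "sym_convex_body (T ` K)"
  unfolding sym_convex_body_def
proof (intro conjI)
  show "compact (T ` K)"
    using assms unfolding sym_convex_body_def
    by (intro compact_continuous_image linear_continuous_on) (auto simp: linear_conv_bounded_linear)
  show "convex (T ` K)" using assms convex_linear_image unfolding sym_convex_body_def by blast
  show "interior (T ` K) \<noteq> {}"
    using assms interior_bijective_linear_image[of T K] unfolding sym_convex_body_def by simp
  have "uminus ` T ` K = T ` uminus ` K"
    using assms(2) by (simp add: image_image linear_neg)
  then show "uminus ` T ` K = T ` K" using assms(1) unfolding sym_convex_body_def by simp
qed

text \<open>
  Take \<open>a, b \<in> K\<close> with maximal determinant and use them as a basis. By Cramer's rule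
  the coordinates of a point of \<open>K\<close> are quotients of determinants of points of
  \<open>K\<close> by the maximal one.
\<close>
lemma exists_auerbach_position:
  assumes K: "sym_convex_body K"
  shows "\<exists>K'. (K, K') \<in> lin_equiv \<and> auerbach_position K'"
proof -
  define D where "D = (\<lambda>(a::real^2, b::real^2). a$1 * b$2 - a$2 * b$1)"
  have comp: "compact (K \<times> K)" using K by (simp add: sym_convex_body_def compact_Times)
  obtain p where p: "p \<in> interior K" using K unfolding sym_convex_body_def by blast
  then obtain r where r: "r > 0" "cball p r \<subseteq> K"
    using mem_interior_cball by blast
  have near: "p + v \<in> K" if "norm v \<le> r" for v
    using r(2) that by (auto simp: dist_norm)
  have n1: "norm (vector [1,0] :: real^2) = 1" "norm (vector [0,1] :: real^2) = 1"
    by (simp_all add: norm_eq_sqrt_inner inner_real2)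
  have "continuous_on (K \<times> K) D"
    unfolding D_def case_prod_unfold by (intro continuous_intros)
  moreover have "K \<times> K \<noteq> {}" using p interior_subset by blast
  ultimately obtain z where z: "z \<in> K \<times> K" "\<And>y. y \<in> K \<times> K \<Longrightarrow> D y \<le> D z"
    using continuous_attains_sup[OF comp] by metis
  obtain a b where zab: "z = (a, b)" by (cases z)
  have ab: "a \<in> K" "b \<in> K" and max: "\<And>x y. x \<in> K \<Longrightarrow> y \<in> K \<Longrightarrow> D (x, y) \<le> D (a, b)"
    using z unfolding zab by auto
  have absD: "\<bar>D (x, y)\<bar> \<le> D (a, b)" if "x \<in> K" "y \<in> K" for x y
    using max[OF that] max[OF that(1) sym_convex_body_uminus[OF K that(2)]] by (simp add: D_def abs_le_iff)
  have Dpos: "D (a, b) > 0"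
  proof (rule ccontr)
    assume "\<not> D (a, b) > 0"
    then have zero: "D (x, y) = 0" if "x \<in> K" "y \<in> K" for x y
      using absD[OF that] by simp
    \<comment> \<open>Moving the second argument along both axes shows that the interior point \<open>q\<close> vanishes.\<close>
    have "q$1 = 0 \<and> q$2 = 0" if q: "q = p + w" "norm w \<le> r/2" for q w
    proof -
      have "q + (r/2) *\<^sub>R e \<in> K" if "norm e = 1" for e
        using norm_triangle_le[of w "(r/2) *\<^sub>R e" r] near[of "w + (r/2) *\<^sub>R e"] q r that
        by (simp add: add.assoc)
      moreover have "q \<in> K" using near[of w] q r by simp
      ultimately have "q \<in> K" "q + (r/2) *\<^sub>R vector [1,0] \<in> K" "q + (r/2) *\<^sub>R vector [0,1] \<in> K"
        using n1 by blast+
      then have "D (q, q + (r/2) *\<^sub>R vector [1,0]) = 0" "D (q, q + (r/2) *\<^sub>R vector [0,1]) = 0"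
        using zero by blast+
      then show ?thesis using r by (simp add: D_def algebra_simps)
    qed
    from this[of p 0] this[of "p + (r/2) *\<^sub>R vector [1,0]" "(r/2) *\<^sub>R vector [1,0]"] show False
      using r n1 by simp
  qed
  define S where "S = (\<lambda>x::real^2. x$1 *\<^sub>R a + x$2 *\<^sub>R b)"
  have linS: "linear S"
    by (rule linearI) (simp_all add: S_def algebra_simps scaleR_add_left)
  have D1: "D (S x, b) = x$1 * D (a, b)" and D2: "D (a, S x) = x$2 * D (a, b)" for x
    by (simp_all add: D_def S_def algebra_simps)
  have "inj S"
  proof (rule injI)
    fix x y assume "S x = S y"
    then have "x$1 * D (a, b) = y$1 * D (a, b)" "x$2 * D (a, b) = y$2 * D (a, b)"
      by (metis D1, metis D2)
    then show "x = y" using Dpos by (simp add: vec2_eq_iff)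
  qed
  then have bijS: "bij S" using linS linear_injective_imp_surjective[of S] by (simp add: bij_def)
  define T where "T = inv S"
  have T: "linear T" "bij T" using linear_bij_inv[OF linS bijS] by (simp_all add: T_def)
  have TS: "T (S x) = x" for x using \<open>inj S\<close> by (simp add: T_def)
  have body: "sym_convex_body (T ` K)" by (rule sym_convex_body_linear_image[OF K T])
  have "S (vector [1,0]) = a" "S (vector [0,1]) = b" by (simp_all add: S_def)
  then have "vector [1,0] \<in> T ` K" "vector [0,1] \<in> T ` K"
    using ab TS by (metis image_eqI)+
  moreover have "\<bar>x$1\<bar> \<le> 1 \<and> \<bar>x$2\<bar> \<le> 1" if x: "x \<in> T ` K" for x
  proof -
    obtain y where "y \<in> K" "x = T y" using x by blast
    then have "S x \<in> K" using bijS by (simp add: T_def bij_is_surj surj_f_inv_f)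
    then have "\<bar>x$1 * D (a, b)\<bar> \<le> D (a, b)" "\<bar>x$2 * D (a, b)\<bar> \<le> D (a, b)"
      using absD[of "S x" b] absD[of a "S x"] ab D1 D2 by auto
    then show ?thesis using Dpos by (simp add: abs_mult)
  qed
  ultimately have "auerbach_position (T ` K)" using body by (simp add: auerbach_position_def)
  then show ?thesis using K body T unfolding lin_equiv_def by blast
qed

definition support :: "(real^2) set \<Rightarrow> real^2 \<Rightarrow> real" where
  "support K u = Sup ((\<lambda>x. x \<bullet> u) ` K)"

text \<open>
  The support function is determined by homogeneity and symmetry from its values on the two segments
  joining \<open>(1, 0)\<close> to \<open>(0, 1)\<close> and to \<open>(0, -1)\<close>. Using it
  instead of the gauge makes convexity immediate, and extending the segments to whole lines keeps the
  slopes bounded beyond the end points.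
\<close>
definition profile :: "(real^2) set \<Rightarrow> nat \<Rightarrow> real \<Rightarrow> real \<Rightarrow> real" where
  "profile K n \<sigma> x = (real n)\<^sup>2 * support K (vector [1 - x / n, \<sigma> * x / n])"

context
  fixes K :: "(real^2) set"
  assumes K: "auerbach_position K"
begin

lemma inner_le_l1: "x \<in> K \<Longrightarrow> x \<bullet> u \<le> \<bar>u$1\<bar> + \<bar>u$2\<bar>"
proof -
  assume "x \<in> K"
  then have "\<bar>x$1\<bar> \<le> 1" "\<bar>x$2\<bar> \<le> 1" using K by (auto simp: auerbach_position_def)
  then have "\<bar>x$1\<bar> * \<bar>u$1\<bar> \<le> 1 * \<bar>u$1\<bar>" "\<bar>x$2\<bar> * \<bar>u$2\<bar> \<le> 1 * \<bar>u$2\<bar>"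
    by (intro mult_right_mono; simp)+
  then have "\<bar>x$1 * u$1\<bar> \<le> \<bar>u$1\<bar>" "\<bar>x$2 * u$2\<bar> \<le> \<bar>u$2\<bar>" by (simp_all add: abs_mult)
  then show ?thesis unfolding inner_real2 by linarith
qed

lemma auerbach_nonempty: "K \<noteq> {}"
  using K by (auto simp: auerbach_position_def)

lemma inner_le_support: "x \<in> K \<Longrightarrow> x \<bullet> u \<le> support K u"
  unfolding support_def
  by (rule cSup_upper) (auto intro!: bdd_aboveI2 inner_le_l1)

lemma support_le: "(\<And>x. x \<in> K \<Longrightarrow> x \<bullet> u \<le> c) \<Longrightarrow> support K u \<le> c"
  unfolding support_def using auerbach_nonempty by (intro cSUP_least)

lemma support_le_l1: "support K u \<le> \<bar>u$1\<bar> + \<bar>u$2\<bar>"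
  by (intro support_le inner_le_l1)

lemma uminus_mem: "x \<in> K \<Longrightarrow> - x \<in> K"
  using K sym_convex_body_uminus by (auto simp: auerbach_position_def)

lemma support_minus: "support K (- u) = support K u"
proof (rule antisym)
  show "support K (- u) \<le> support K u"
    using inner_le_support[OF uminus_mem, of _ u] by (intro support_le) simp
  show "support K u \<le> support K (- u)"
    using inner_le_support[OF uminus_mem, of _ "- u"] by (intro support_le) simp
qed

lemma support_axis: "support K (vector [1,0]) = 1"
proof (rule antisym)
  show "support K (vector [1,0]) \<le> 1" using support_le_l1[of "vector [1,0]"] by simp
  have "vector [1,0] \<in> K" using K by (simp add: auerbach_position_def)
  from inner_le_support[OF this, of "vector [1,0]"] show "1 \<le> support K (vector [1,0])"
    by (simp add: inner_real2)
qed

lemma support_ge: "\<bar>u$1\<bar> + \<bar>u$2\<bar> \<le> 2 * support K u"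
proof -
  have "\<bar>u$1\<bar> \<le> support K u" "\<bar>u$2\<bar> \<le> support K u"
  proof -
    have e: "vector [1,0] \<in> K" "vector [0,1] \<in> K" using K by (auto simp: auerbach_position_def)
    show "\<bar>u$1\<bar> \<le> support K u"
      using inner_le_support[OF e(1), of u] inner_le_support[OF uminus_mem[OF e(1)], of u]
      by (simp add: inner_real2)
    show "\<bar>u$2\<bar> \<le> support K u"
      using inner_le_support[OF e(2), of u] inner_le_support[OF uminus_mem[OF e(2)], of u]
      by (simp add: inner_real2)
  qed
  then show ?thesis by simp
qed

lemma support_add: "support K (u + v) \<le> support K u + support K v"
  using inner_le_support[of _ u] inner_le_support[of _ v]
  by (intro support_le) (simp add: inner_add_right add_mono)

lemma support_scale: 
  assumes "t \<ge> 0" shows "support K (t *\<^sub>R u) = t * support K u"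
proof (rule antisym)
  show "support K (t *\<^sub>R u) \<le> t * support K u"
    using inner_le_support[of _ u] assms by (intro support_le) (simp add: mult_left_mono)
  show "t * support K u \<le> support K (t *\<^sub>R u)"
  proof (cases "t = 0")
    case True
    then show ?thesis using support_ge[of 0] by simp
  next
    case False
    then have t: "t > 0" using assms by simp
    have "support K u \<le> support K (t *\<^sub>R u) / t"
      using inner_le_support[of _ "t *\<^sub>R u"] t by (intro support_le) (simp add: field_simps)
    then show ?thesis using t by (simp add: field_simps)
  qed
qed

lemma abs_support_diff: "\<bar>support K u - support K v\<bar> \<le> \<bar>u$1 - v$1\<bar> + \<bar>u$2 - v$2\<bar>"
proof -
  have "support K u \<le> support K v + support K (u - v)" "support K v \<le> support K u + support K (v - u)"
    using support_add[of v "u - v"] support_add[of u "v - u"] by simp_all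
  then show ?thesis using support_le_l1[of "u - v"] support_le_l1[of "v - u"]
    by (simp add: abs_minus_commute)
qed

lemma steep_convex_profile:
  assumes n: "n > 0" and \<sigma>: "\<bar>\<sigma>\<bar> = 1"
  shows "steep_convex n (profile K n \<sigma>)"
proof
  show "n > 0" by fact
  show "profile K n \<sigma> 0 = (real n)\<^sup>2" by (simp add: profile_def support_axis)
  show "\<bar>profile K n \<sigma> x - profile K n \<sigma> y\<bar> \<le> 2 * real n * \<bar>x - y\<bar>" for x y
  proof -
    let ?u = "vector [1 - x / n, \<sigma> * x / n] :: real^2" and ?v = "vector [1 - y / n, \<sigma> * y / n] :: real^2"
    have "\<bar>support K ?u - support K ?v\<bar> \<le> \<bar>?u$1 - ?v$1\<bar> + \<bar>?u$2 - ?v$2\<bar>" by (rule abs_support_diff)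
    also have "?u$1 - ?v$1 = (y - x) / n" by (simp add: diff_divide_distrib)
    also have "?u$2 - ?v$2 = \<sigma> * ((x - y) / n)" by (simp add: diff_divide_distrib right_diff_distrib)
    also have "\<bar>(y - x) / n\<bar> + \<bar>\<sigma> * ((x - y) / n)\<bar> = 2 * \<bar>x - y\<bar> / n"
      unfolding abs_mult \<sigma> by (simp add: abs_minus_commute)
    finally have "\<bar>support K ?u - support K ?v\<bar> \<le> 2 * \<bar>x - y\<bar> / n" .
    then have "(real n)\<^sup>2 * \<bar>support K ?u - support K ?v\<bar> \<le> (real n)\<^sup>2 * (2 * \<bar>x - y\<bar> / n)"
      by (intro mult_left_mono) auto
    also have "\<dots> = 2 * real n * \<bar>x - y\<bar>" using n by (simp add: power2_eq_square)
    finally show ?thesis by (simp add: profile_def abs_mult flip: right_diff_distrib)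
  qed
  show "convex_on UNIV (profile K n \<sigma>)"
  proof (rule convex_onI)
    fix t x y :: real assume t: "0 < t" "t < 1"
    let ?u = "\<lambda>x. vector [1 - x / n, \<sigma> * x / n] :: real^2"
    have "?u ((1 - t) *\<^sub>R x + t *\<^sub>R y) = (1 - t) *\<^sub>R ?u x + t *\<^sub>R ?u y"
      using n by (simp add: vec2_eq_iff field_simps)
    then have "support K (?u ((1 - t) *\<^sub>R x + t *\<^sub>R y)) \<le> (1 - t) * support K (?u x) + t * support K (?u y)"
      using support_add[of "(1 - t) *\<^sub>R ?u x" "t *\<^sub>R ?u y"] support_scale[of "1 - t" "?u x"] support_scale[of t "?u y"] t
      by simp
    then have "(real n)\<^sup>2 * support K (?u ((1 - t) *\<^sub>R x + t *\<^sub>R y)) \<le> (real n)\<^sup>2 * ((1 - t) * support K (?u x) + t * support K (?u y))"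
      by (intro mult_left_mono) auto
    then show "profile K n \<sigma> ((1 - t) *\<^sub>R x + t *\<^sub>R y) \<le> (1 - t) * profile K n \<sigma> x + t * profile K n \<sigma> y"
      by (simp add: profile_def algebra_simps)
  qed simp
qed

end

text \<open>
  An additive error on the two segments becomes a relative one, as the support function is at least
  \<open>1/2\<close> there.
\<close>
lemma support_comparison:
  assumes K: "auerbach_position K" and L: "auerbach_position L" and n: "n > 0"
    and close: "\<And>\<sigma> x. \<sigma> \<in> {1,-1} \<Longrightarrow> 0 \<le> x \<Longrightarrow> x \<le> real n \<Longrightarrow>
      \<bar>profile K n \<sigma> x - profile L n \<sigma> x\<bar> \<le> 2"
  shows "support K u \<le> (1 + 4 / (real n)\<^sup>2) * support L u"
proof -
  define s where "s = \<bar>u$1\<bar> + \<bar>u$2\<bar>"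
  show ?thesis
  proof (cases "s = 0")
    case True
    then have "support K u \<le> 0" "support L u \<ge> 0"
      using support_le_l1[OF K, of u] support_ge[OF L, of u] by (simp_all add: s_def)
    moreover from this have "0 \<le> (1 + 4 / (real n)\<^sup>2) * support L u" by simp
    ultimately show ?thesis by linarith
  next
    case False
    then have s: "s > 0" by (simp add: s_def)
    define \<sigma> :: real where "\<sigma> = (if u$1 * u$2 \<ge> 0 then 1 else -1)"
    define x where "x = n * \<bar>u$2\<bar> / s"
    define v :: "real^2" where "v = vector [1 - x / n, \<sigma> * x / n]"
    have "\<bar>u$2\<bar> \<le> s" by (simp add: s_def)
    then have x: "0 \<le> x" "x \<le> real n" using n s by (auto simp: x_def field_simps)
    have "s * (1 - x / n) = s - \<bar>u$2\<bar>" "s * (\<sigma> * x / n) = \<sigma> * \<bar>u$2\<bar>"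
      using n s by (simp_all add: x_def field_simps)
    then have sv: "(s *\<^sub>R v)$1 = \<bar>u$1\<bar>" "(s *\<^sub>R v)$2 = \<sigma> * \<bar>u$2\<bar>"
      by (simp_all add: v_def s_def)
    have "u = s *\<^sub>R v \<or> u = - (s *\<^sub>R v)"
      using sv unfolding vec2_eq_iff uminus_vec_def \<sigma>_def
      by (auto simp: abs_if zero_le_mult_iff not_le mult_less_0_iff split: if_splits)
    then have eq: "support K u = s * support K v" "support L u = s * support L v"
      using s support_minus[OF K] support_minus[OF L] support_scale[OF K] support_scale[OF L] by auto
    have "\<bar>(real n)\<^sup>2 * support K v - (real n)\<^sup>2 * support L v\<bar> \<le> 2"
      using close[of \<sigma> x] x unfolding profile_def v_def by (simp add: \<sigma>_def)
    then have "(real n)\<^sup>2 * support K v \<le> (real n)\<^sup>2 * support L v + 2" by linarith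
    then have "support K v \<le> support L v + 2 / (real n)\<^sup>2"
      using n by (simp add: field_simps)
    then have "s * support K v \<le> s * (support L v + 2 / (real n)\<^sup>2)"
      using s by (intro mult_left_mono) auto
    also have "\<dots> = support L u + 2 * s / (real n)\<^sup>2" by (simp add: eq algebra_simps)
    also have "2 * s / (real n)\<^sup>2 \<le> 4 * support L u / (real n)\<^sup>2"
      using support_ge[OF L, of u] by (intro divide_right_mono) (auto simp: s_def)
    finally show ?thesis by (simp add: eq(1) algebra_simps)
  qed
qed

lemma subset_scale_of_support_le:
  assumes K: "auerbach_position K" and L: "auerbach_position L" and c: "c > 0"
    and le: "\<And>u. support K u \<le> c * support L u"
  shows "K \<subseteq> (*\<^sub>R) c ` L"
proof
  fix x assume x: "x \<in> K"
  have comp: "compact L" "convex L" using L by (auto simp: auerbach_position_def sym_convex_body_def)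
  show "x \<in> (*\<^sub>R) c ` L"
  proof (rule ccontr)
    assume "x \<notin> (*\<^sub>R) c ` L"
    moreover have "convex ((*\<^sub>R) c ` L)" "closed ((*\<^sub>R) c ` L)"
      using comp by (simp_all add: convex_scaling compact_imp_closed compact_scaling)
    ultimately obtain a b where ab: "a \<bullet> x < b" "\<And>y. y \<in> (*\<^sub>R) c ` L \<Longrightarrow> b < a \<bullet> y"
      using separating_hyperplane_closed_point[of "(*\<^sub>R) c ` L" x] by blast
    have "support L (- a) \<le> - b / c"
    proof (rule support_le[OF L])
      fix y assume "y \<in> L"
      from ab(2)[OF imageI[OF this]] have "b < c * (a \<bullet> y)" by simp
      then have "b / c < a \<bullet> y" using c by (simp add: field_simps)
      then show "y \<bullet> - a \<le> - b / c" by (simp add: inner_commute)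
    qed
    then have "c * support L (- a) \<le> - b" using c by (simp add: field_simps)
    moreover have "- (a \<bullet> x) \<le> support K (- a)"
      using inner_le_support[OF K x, of "- a"] by (simp add: inner_commute)
    ultimately show False using le[of "- a"] ab(1) by simp
  qed
qed

lemma BM_dist_le:
  assumes "r > 0" "linear T" "bij T" "K \<subseteq> T ` L" "T ` L \<subseteq> (*\<^sub>R) r ` K"
  shows "BM_dist K L \<le> r"
  unfolding BM_dist_def using assms by (intro cInf_lower bdd_belowI[of _ 0]) auto

lemma scaling_linear_bij: "c \<noteq> 0 \<Longrightarrow> linear ((*\<^sub>R) c :: real^2 \<Rightarrow> real^2) \<and> bij ((*\<^sub>R) c :: real^2 \<Rightarrow> real^2)"
  by (auto simp: bij_def inj_def surj_def intro!: linearI exI[of _ "_ /\<^sub>R c"] scaleR_add_right)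

lemma BM_dist_le_of_profiles:
  assumes K: "auerbach_position K" and L: "auerbach_position L" and n: "n > 0"
    and close: "\<And>\<sigma> x. \<sigma> \<in> {1,-1} \<Longrightarrow> 0 \<le> x \<Longrightarrow> x \<le> real n \<Longrightarrow>
      \<bar>profile K n \<sigma> x - profile L n \<sigma> x\<bar> \<le> 2"
  shows "BM_dist K L \<le> (1 + 4 / (real n)\<^sup>2)\<^sup>2"
proof -
  define c where "c = 1 + 4 / (real n)\<^sup>2"
  have c: "c > 0" unfolding c_def by (simp add: add_pos_nonneg)
  have KL: "K \<subseteq> (*\<^sub>R) c ` L"
    using support_comparison[OF K L n close] by (intro subset_scale_of_support_le K L c) (auto simp: c_def)
  have "L \<subseteq> (*\<^sub>R) c ` K"
    using support_comparison[OF L K n] close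
    by (intro subset_scale_of_support_le K L c) (auto simp: c_def abs_minus_commute)
  then have "(*\<^sub>R) c ` L \<subseteq> (*\<^sub>R) c ` (*\<^sub>R) c ` K" by (rule image_mono)
  also have "\<dots> = (*\<^sub>R) (c\<^sup>2) ` K" by (simp add: image_image power2_eq_square)
  finally have "(*\<^sub>R) c ` L \<subseteq> (*\<^sub>R) (c\<^sup>2) ` K" .
  then show ?thesis using BM_dist_le[OF _ _ _ KL] c scaling_linear_bij[of c] by (simp add: c_def)
qed

text \<open>
  Choosing a representative in Auerbach position for each class, the codes of its two profiles are
  injective on a separated set and range over a set of size \<open>2 ^ O(n)\<close>.
\<close>
lemma separated_card_bound:
  assumes S: "BM_separated d S" and n: "n > 0" and d: "(1 + 4 / (real n)\<^sup>2)\<^sup>2 < d"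
  shows "finite S \<and> card S \<le> 2 ^ (316 * n)"
proof -
  have "\<exists>K\<in>X. auerbach_position K" if X: "X \<in> S" for X
  proof -
    have "X \<in> {K. sym_convex_body K} // lin_equiv"
      using S X by (auto simp: BM_separated_def BM_compactum_def)
    then obtain K where K: "sym_convex_body K" "X = lin_equiv `` {K}" by (auto elim: quotientE)
    then show ?thesis using exists_auerbach_position[OF K(1)] by auto
  qed
  then obtain rep where rep: "\<And>X. X \<in> S \<Longrightarrow> rep X \<in> X" "\<And>X. X \<in> S \<Longrightarrow> auerbach_position (rep X)"
    by metis
  define cc where "cc = (\<lambda>X \<sigma>. steep_convex.coarse_code n (profile (rep X) n \<sigma>))"
  define fc where "fc = (\<lambda>X \<sigma>. steep_convex.fine_code n (profile (rep X) n \<sigma>))"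
  define A where "A = {- 2 * int n - 2..4 * int n + 2}"
  define B where "B = {- 4 * int n..12 * int n + 4} \<times> {-2..4::int}"
  define code where "code = (\<lambda>X. ((cc X 1, fc X 1), (cc X (-1), fc X (-1))))"
  have sc: "steep_convex n (profile (rep X) n \<sigma>)" if "X \<in> S" "\<sigma> \<in> {1,-1}" for X \<sigma>
    using steep_convex_profile[OF rep(2) n] that by auto
  have inj: "inj_on code S"
  proof (rule inj_onI, rule ccontr)
    fix X Y assume XY: "X \<in> S" "Y \<in> S" "code X = code Y" "X \<noteq> Y"
    have "\<bar>profile (rep X) n \<sigma> x - profile (rep Y) n \<sigma> x\<bar> \<le> 2"
      if "\<sigma> \<in> {1,-1}" "0 \<le> x" "x \<le> real n" for \<sigma> x
      using XY(3) that by (intro equal_codes_close[OF sc sc] XY) (auto simp: code_def cc_def fc_def)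
    then have "BM_dist (rep X) (rep Y) \<le> (1 + 4 / (real n)\<^sup>2)\<^sup>2"
      by (intro BM_dist_le_of_profiles rep XY n)
    moreover have "BM_class_dist X Y = BM_dist (rep X) (rep Y)"
      using S XY rep by (intro BM_class_dist_eq) (auto simp: BM_separated_def)
    ultimately show False using S XY d by (force simp: BM_separated_def)
  qed
  have codes: "cc X \<sigma> \<in> Pow A \<and> fc X \<sigma> \<in> Pow B" if "X \<in> S" "\<sigma> \<in> {1,-1}" for X \<sigma>
    using steep_convex.coarse_code_subset[OF sc[OF that]] steep_convex.fine_code_subset[OF sc[OF that]]
    by (simp only: cc_def fc_def A_def B_def Pow_iff)
  have sub: "code ` S \<subseteq> (Pow A \<times> Pow B) \<times> (Pow A \<times> Pow B)"
    using codes by (intro image_subsetI) (simp only: code_def mem_Times_iff fst_conv snd_conv insert_iff simp_thms)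
  have fin: "finite A" "finite B" by (simp_all add: A_def B_def)
  have card: "card A = 6 * n + 5" "card B = (16 * n + 5) * 7"
    by (simp_all add: A_def B_def card_cartesian_product)
  have "finite (code ` S)" by (rule finite_subset[OF sub]) (simp add: fin)
  then have finS: "finite S" using inj by (rule finite_imageD)
  have "card S = card (code ` S)" using inj by (simp add: card_image)
  also have "\<dots> \<le> card ((Pow A \<times> Pow B) \<times> (Pow A \<times> Pow B))"
    using sub fin by (intro card_mono) auto
  also have "\<dots> = 2 ^ ((6 * n + 5 + (16 * n + 5) * 7) * 2)"
    by (simp only: card_cartesian_product card_Pow[OF fin(1)] card_Pow[OF fin(2)] card
        power_add[symmetric] mult_2_right)
  also have "\<dots> \<le> 2 ^ (316 * n)" using n by (intro power_increasing) auto
  finally show ?thesis using finS by simp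
qed

section \<open>Discs with removed caps and the lower bound for their distance\<close>

definition dir :: "real \<Rightarrow> real^2" where
  "dir \<theta> = vector [cos \<theta>, sin \<theta>]"

lemma inner_dir: "dir \<theta> \<bullet> dir \<omega> = cos (\<theta> - \<omega>)"
  by (simp add: dir_def inner_real2 cos_diff)

lemma norm_dir [simp]: "norm (dir \<theta>) = 1"
  by (simp add: norm_eq_sqrt_inner inner_dir)

lemma coords_dir: "v$1 = v \<bullet> dir 0" "v$2 = v \<bullet> dir (pi/2)"
  by (simp_all add: dir_def inner_real2)

definition capped_disc :: "real \<Rightarrow> real set \<Rightarrow> (real^2) set" where
  "capped_disc h A = {y. norm y \<le> 1 \<and> (\<forall>\<theta>\<in>A. \<bar>y \<bullet> dir \<theta>\<bar> \<le> h)}"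

lemma capped_disc_subset: "capped_disc h A \<subseteq> cball 0 1"
  by (auto simp: capped_disc_def)

lemma cball_subset_capped_disc:
  assumes "h \<le> 1" shows "cball 0 h \<subseteq> capped_disc h A"
proof
  fix y :: "real^2" assume "y \<in> cball 0 h"
  then have y: "norm y \<le> h" by simp
  then have "\<bar>y \<bullet> dir \<theta>\<bar> \<le> h" for \<theta>
    using Cauchy_Schwarz_ineq2[of y "dir \<theta>"] by simp
  then show "y \<in> capped_disc h A" using y assms by (simp add: capped_disc_def)
qed

lemma sym_convex_body_capped_disc:
  assumes "0 < h" "h \<le> 1" shows "sym_convex_body (capped_disc h A)"
  unfolding sym_convex_body_def
proof (intro conjI)
  have eq: "capped_disc h A = cball 0 1 \<inter> (\<Inter>\<theta>\<in>A. {y. dir \<theta> \<bullet> y \<le> h} \<inter> {y. dir \<theta> \<bullet> y \<ge> - h})"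
    by (auto simp: capped_disc_def abs_le_iff inner_commute minus_le_iff)
  have "closed (\<Inter>\<theta>\<in>A. {y. dir \<theta> \<bullet> y \<le> h} \<inter> {y. dir \<theta> \<bullet> y \<ge> - h})"
    by (intro closed_INT ballI closed_Int closed_halfspace_le closed_halfspace_ge)
  then show "compact (capped_disc h A)"
    unfolding eq by (intro compact_Int_closed compact_cball)
  show "convex (capped_disc h A)"
    unfolding eq
    by (intro convex_Int convex_cball convex_INT convex_halfspace_le convex_halfspace_ge)
  have "ball 0 h \<subseteq> interior (capped_disc h A)"
    using cball_subset_capped_disc[OF assms(2), of A] ball_subset_cball
    by (intro interior_maximal) (auto simp: subset_iff)
  then show "interior (capped_disc h A) \<noteq> {}" using assms(1) by fastforce
  show "uminus ` capped_disc h A = capped_disc h A"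
  proof
    show "uminus ` capped_disc h A \<subseteq> capped_disc h A"
      by (auto simp: capped_disc_def)
    then have "uminus ` uminus ` capped_disc h A \<subseteq> uminus ` capped_disc h A" by (rule image_mono)
    then show "capped_disc h A \<subseteq> uminus ` capped_disc h A" by (simp add: image_image)
  qed
qed

lemma capped_discs_within:
  assumes h: "0 < h" "h \<le> 1"
  shows "\<exists>T. linear T \<and> bij T \<and> capped_disc h A \<subseteq> T ` capped_disc h B \<and>
    T ` capped_disc h B \<subseteq> (*\<^sub>R) (1/h\<^sup>2) ` capped_disc h A"
proof (intro exI conjI)
  have in_scaled: "cball 0 1 \<subseteq> (*\<^sub>R) (1/h) ` capped_disc h C" for C
  proof
    fix y :: "real^2" assume "y \<in> cball 0 1"
    then have "h *\<^sub>R y \<in> cball 0 h" using h mult_left_mono[of "norm y" 1 h] by simp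
    then have "h *\<^sub>R y \<in> capped_disc h C" using cball_subset_capped_disc[OF h(2)] by blast
    moreover have "y = (1/h) *\<^sub>R (h *\<^sub>R y)" using h by simp
    ultimately show "y \<in> (*\<^sub>R) (1/h) ` capped_disc h C" by (rule rev_image_eqI)
  qed
  show "capped_disc h A \<subseteq> (*\<^sub>R) (1/h) ` capped_disc h B"
    using capped_disc_subset in_scaled by (rule subset_trans)
  have "capped_disc h B \<subseteq> (*\<^sub>R) (1/h) ` capped_disc h A"
    using capped_disc_subset in_scaled by (rule subset_trans)
  then have "(*\<^sub>R) (1/h) ` capped_disc h B \<subseteq> (*\<^sub>R) (1/h) ` (*\<^sub>R) (1/h) ` capped_disc h A"
    by (rule image_mono)
  then show "(*\<^sub>R) (1/h) ` capped_disc h B \<subseteq> (*\<^sub>R) (1/h\<^sup>2) ` capped_disc h A"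
    by (simp add: image_image power2_eq_square)
  show "linear ((*\<^sub>R) (1/h) :: real^2 \<Rightarrow> real^2)" "bij ((*\<^sub>R) (1/h) :: real^2 \<Rightarrow> real^2)"
    using scaling_linear_bij[of "1/h"] h by auto
qed

text \<open>
  In complex notation \<open>T z = p z + q (cnj z)\<close>: the sum of a similarity preserving
  and a similarity reversing the orientation, with factors \<open>P\<close> and \<open>Q\<close>. The
  form in terms of inner products shows both \<open>T\<close> and its adjoint at once.
\<close>
lemma linear_polar_form:
  fixes T :: "real^2 \<Rightarrow> real^2"
  assumes T: "linear T"
  shows "\<exists>P Q \<phi> \<psi>. P \<ge> 0 \<and> Q \<ge> 0 \<and>
    (\<forall>\<theta> \<omega>. T (dir \<theta>) \<bullet> dir \<omega> = P * cos (\<theta> - \<omega> + \<phi>) + Q * cos (\<theta> + \<omega> - \<psi>))"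
proof -
  define u v where "u = T (vector [1,0])" and "v = T (vector [0,1])"
  have Tdir: "T (dir \<theta>) = cos \<theta> *\<^sub>R u + sin \<theta> *\<^sub>R v" for \<theta>
  proof -
    have "dir \<theta> = cos \<theta> *\<^sub>R vector [1,0] + sin \<theta> *\<^sub>R vector [0,1]"
      by (simp add: dir_def vec2_eq_iff)
    then show ?thesis using T by (simp add: linear_add linear_cmul u_def v_def)
  qed
  have polar: "\<exists>r a. r \<ge> 0 \<and> x = r * cos a \<and> y = r * sin a" for x y :: real
  proof -
    obtain a where "Complex x y = rcis (cmod (Complex x y)) a"
      using rcis_cmod_Arg by metis
    then have "x = cmod (Complex x y) * cos a" "y = cmod (Complex x y) * sin a"
      by (metis Re_rcis complex.sel(1), metis Im_rcis complex.sel(2))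
    then show ?thesis using norm_ge_zero by blast
  qed
  obtain P \<phi> where P: "P \<ge> 0" "(u$1 + v$2) / 2 = P * cos \<phi>" "(u$2 - v$1) / 2 = P * sin \<phi>"
    using polar by blast
  obtain Q \<psi> where Q: "Q \<ge> 0" "(u$1 - v$2) / 2 = Q * cos \<psi>" "(u$2 + v$1) / 2 = Q * sin \<psi>"
    using polar by blast
  have uv: "u$1 = P * cos \<phi> + Q * cos \<psi>" "v$2 = P * cos \<phi> - Q * cos \<psi>"
    "u$2 = P * sin \<phi> + Q * sin \<psi>" "v$1 = Q * sin \<psi> - P * sin \<phi>"
    unfolding P(2,3)[symmetric] Q(2,3)[symmetric] by (simp_all add: field_simps)
  have "T (dir \<theta>) \<bullet> dir \<omega> = P * cos (\<theta> - \<omega> + \<phi>) + Q * cos (\<theta> + \<omega> - \<psi>)" for \<theta> \<omega>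
    unfolding Tdir inner_real2
    by (simp add: uv dir_def cos_add cos_diff sin_add sin_diff algebra_simps)
  then show ?thesis using P(1) Q(1) by blast
qed

lemma norm_two_directions:
  assumes "\<And>\<omega>. v \<bullet> dir \<omega> = P * cos (\<alpha> - \<omega>) + Q * cos (\<beta> - \<omega>)"
  shows "(norm v)\<^sup>2 = P\<^sup>2 + Q\<^sup>2 + 2 * P * Q * cos (\<alpha> - \<beta>)"
proof -
  have "v$1 = P * cos \<alpha> + Q * cos \<beta>" "v$2 = P * sin \<alpha> + Q * sin \<beta>"
    unfolding coords_dir assms by (simp_all add: cos_diff)
  then have "v$1 * v$1 + v$2 * v$2 = P\<^sup>2 * ((cos \<alpha>)\<^sup>2 + (sin \<alpha>)\<^sup>2) + Q\<^sup>2 * ((cos \<beta>)\<^sup>2 + (sin \<beta>)\<^sup>2)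
      + 2 * P * Q * cos (\<alpha> - \<beta>)"
    unfolding cos_diff by algebra
  then show ?thesis unfolding power2_norm_eq_inner inner_real2 by simp
qed

lemma abs_cos_le:
  assumes far: "\<And>k::int. t \<le> \<bar>y - k * pi\<bar>" and t: "0 \<le> t"
  shows "\<bar>cos y\<bar> \<le> cos t"
proof -
  define k where "k = round (y / pi)"
  define z where "z = y - k * pi"
  have "\<bar>y / pi - k\<bar> \<le> 1/2" using of_int_round_abs_le[of "y / pi"] by (simp add: k_def abs_minus_commute)
  moreover have "z = (y / pi - k) * pi" by (simp add: z_def left_diff_distrib)
  ultimately have z: "\<bar>z\<bar> \<le> pi / 2" by (simp add: abs_mult mult_right_mono)
  have "\<bar>cos y\<bar> = \<bar>cos (z + pi * k)\<bar>" by (simp add: z_def mult.commute)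
  also have "\<dots> = \<bar>cos z\<bar>" by (simp add: cos_add sin_npi_int cos_npi_int)
  also have "\<dots> = cos \<bar>z\<bar>" using z by (simp add: cos_ge_zero)
  also have "\<dots> \<le> cos t" using far[of k] t z pi_ge_zero by (intro cos_monotone_0_pi_le) (auto simp: z_def)
  finally show ?thesis .
qed

text \<open>
  The sinusoid in \<open>2 * \<theta>\<close> selects the directions where a linear map, or its
  adjoint, stretches more, or less, than on average; \<open>\<epsilon>\<close> and \<open>\<phi>\<close>
  stand for the rotation or reflection by which the map nearly acts on directions. A chord takes away
  the directions at an angle below \<open>x\<close> only; the rest is a margin for maps that are merely
  close to a rotation or reflection.
\<close>
definition spread :: "real \<Rightarrow> real set \<Rightarrow> real set \<Rightarrow> bool" where
  "spread x A B \<longleftrightarrow> (\<forall>\<epsilon>\<in>{1,-1}. \<forall>\<phi> \<alpha>. \<exists>\<theta>\<in>A. cos (2 * \<theta> + \<alpha>) \<ge> 0 \<and>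
     (\<forall>\<omega>\<in>B. \<bar>cos (\<theta> - \<epsilon> * \<omega> - \<phi>)\<bar> \<le> cos (3 * x)))"

text \<open>
  With \<open>h = cos x\<close>, the polynomial \<open>4 * h^3 - 3 * h\<close> is
  \<open>cos (3 * x)\<close>. The distortion hypothesis \<open>pq\<close> gives
  \<open>q / p\<close> at most about \<open>x\<^sup>2\<close>, while the margin
  \<open>cos x - cos (3 * x)\<close> is about \<open>4 * x\<^sup>2\<close>.
\<close>
lemma dominant_term_bound:
  fixes p q h :: real
  assumes h: "9/10 \<le> h" "h \<le> 1" and p: "p \<ge> 0" and q: "q \<ge> 0" and pq: "h^4 * (p + q) \<le> p - q"
  shows "p * (4 * h^3 - 3 * h) + q \<le> h * (p - q)"
proof -
  have h4: "h^4 \<ge> 3/5" using power_mono[OF h(1), of 4] by (simp add: power_divide)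
  have "q * (1 + h^4) \<le> p * (1 - h^4)" using pq by (simp add: algebra_simps)
  also have "p * (1 - h^4) = p * (1 - h\<^sup>2) * (1 + h\<^sup>2)" by algebra
  finally have A: "q * (1 + h^4) \<le> p * (1 - h\<^sup>2) * (1 + h\<^sup>2)" .
  have h2: "h\<^sup>2 \<le> 1" using h by (simp add: power_le_one)
  have "(1 + h) * (1 + h\<^sup>2) \<le> 2 * 2" using h h2 by (intro mult_mono) auto
  also have "2 * 2 \<le> 4 * (h * (1 + h^4))"
  proof -
    have "(9/10) * (8/5) \<le> h * (1 + h^4)" using h h4 by (intro mult_mono) auto
    then show ?thesis by simp
  qed
  finally have B: "(1 + h) * (1 + h\<^sup>2) \<le> 4 * h * (1 + h^4)" by simp
  have "q * (1 + h) * (1 + h^4) \<le> (1 + h) * (p * (1 - h\<^sup>2) * (1 + h\<^sup>2))"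
    using mult_left_mono[OF A, of "1 + h"] h by (simp add: mult_ac)
  also have "\<dots> = p * (1 - h\<^sup>2) * ((1 + h) * (1 + h\<^sup>2))" by (simp add: mult_ac)
  also have "\<dots> \<le> p * (1 - h\<^sup>2) * (4 * h * (1 + h^4))"
    using p h2 by (intro mult_left_mono B) auto
  finally have "q * (1 + h) * (1 + h^4) \<le> (p * (1 - h\<^sup>2) * (4 * h)) * (1 + h^4)"
    by (simp only: mult_ac)
  then have "q * (1 + h) \<le> p * (1 - h\<^sup>2) * (4 * h)" using h4 by (simp add: mult_le_cancel_right)
  then show ?thesis by (simp add: algebra_simps power2_eq_square power3_eq_cube)
qed

lemma two_term_bound:
  fixes P Q h c d :: real
  assumes h: "9/10 \<le> h" "h \<le> 1" and PQ: "P \<ge> 0" "Q \<ge> 0" "h^4 * (P + Q) \<le> \<bar>P - Q\<bar>"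
    and cos: "\<bar>c\<bar> \<le> 1" "\<bar>d\<bar> \<le> 1"
    and small: "P > Q \<Longrightarrow> \<bar>c\<bar> \<le> 4 * h^3 - 3 * h" "P \<le> Q \<Longrightarrow> \<bar>d\<bar> \<le> 4 * h^3 - 3 * h"
  shows "\<bar>P * c + Q * d\<bar> \<le> h * \<bar>P - Q\<bar>"
proof -
  have tri: "\<bar>P * c + Q * d\<bar> \<le> P * \<bar>c\<bar> + Q * \<bar>d\<bar>"
    using PQ abs_triangle_ineq[of "P * c" "Q * d"] by (simp add: abs_mult)
  show ?thesis
  proof (cases "P > Q")
    case True
    have "P * \<bar>c\<bar> + Q * \<bar>d\<bar> \<le> P * (4 * h^3 - 3 * h) + Q * 1"
      using small True PQ cos by (intro add_mono mult_left_mono) auto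
    also have "\<dots> \<le> h * (P - Q)" using dominant_term_bound[OF h PQ(1,2)] PQ True by simp
    finally show ?thesis using tri True by simp
  next
    case False
    have "P * \<bar>c\<bar> + Q * \<bar>d\<bar> \<le> P * 1 + Q * (4 * h^3 - 3 * h)"
      using small False PQ cos by (intro add_mono mult_left_mono) auto
    also have "\<dots> \<le> h * (Q - P)"
      using dominant_term_bound[OF h PQ(2,1)] PQ False by (simp add: add.commute)
    finally show ?thesis using tri False by simp
  qed
qed

text \<open>
  The two inclusions bound the singular values \<open>P + Q\<close> and
  \<open>\<bar>P - Q\<bar>\<close> of \<open>T\<close>, so one of \<open>P\<close> and
  \<open>Q\<close> dominates and \<open>T\<close> acts on directions nearly as a rotation or a
  reflection. The comparison value \<open>c\<close> has to be the quadratic mean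
  \<open>sqrt (P\<^sup>2 + Q\<^sup>2)\<close>, which is the same for \<open>T\<close> and its adjoint
  and makes the sets where \<open>T\<close> shrinks and where the adjoint expands, relative to
  \<open>c\<close>, half circles of the doubled angle.
\<close>
lemma spread_distance_ge:
  fixes T :: "real^2 \<Rightarrow> real^2"
  assumes h: "h = cos x" "9/10 \<le> h" 
    and AB: "spread x A B" "spread x B A" and T: "linear T" "inj T" and r: "r > 0"
    and sub: "capped_disc h A \<subseteq> T ` capped_disc h B" "T ` capped_disc h B \<subseteq> (*\<^sub>R) r ` capped_disc h A"
  shows "1 / h\<^sup>2 \<le> r"
proof (rule ccontr)
  assume "\<not> 1 / h\<^sup>2 \<le> r"
  have h1: "h \<le> 1" using h(1) by simp
  then have rh: "r * h\<^sup>2 < 1" using \<open>\<not> 1 / h\<^sup>2 \<le> r\<close> h(2) by (simp add: field_simps)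
  have cos3: "cos (3 * x) = 4 * h^3 - 3 * h" using h(1) by (simp add: cos_treble_cos)
  obtain P Q \<phi> \<psi> where PQ: "P \<ge> 0" "Q \<ge> 0" and
    polar: "\<And>\<theta> \<omega>. T (dir \<theta>) \<bullet> dir \<omega> = P * cos (\<theta> - \<omega> + \<phi>) + Q * cos (\<theta> + \<omega> - \<psi>)"
    using linear_polar_form[OF T(1)] by blast
  define T' where "T' = adjoint T"
  have adj: "y \<bullet> T' z = T y \<bullet> z" for y z unfolding T'_def by (rule adjoint_works[OF T(1)])
  have normT: "(norm (T (dir \<theta>)))\<^sup>2 = P\<^sup>2 + Q\<^sup>2 + 2 * P * Q * cos (2 * \<theta> + \<phi> - \<psi>)" for \<theta>
  proof -
    have "T (dir \<theta>) \<bullet> dir \<omega> = P * cos ((\<theta> + \<phi>) - \<omega>) + Q * cos ((\<psi> - \<theta>) - \<omega>)" for \<omega>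
      unfolding polar using cos_minus[of "\<theta> + \<omega> - \<psi>"] by (simp add: algebra_simps)
    from norm_two_directions[OF this] show ?thesis by (simp add: algebra_simps)
  qed
  have normT': "(norm (T' (dir \<omega>)))\<^sup>2 = P\<^sup>2 + Q\<^sup>2 + 2 * P * Q * cos (2 * \<omega> - \<phi> - \<psi>)" for \<omega>
  proof -
    have "T' (dir \<omega>) \<bullet> dir \<theta> = P * cos ((\<omega> - \<phi>) - \<theta>) + Q * cos ((\<psi> - \<omega>) - \<theta>)" for \<theta>
      using adj[of "dir \<theta>" "dir \<omega>"] cos_minus[of "\<theta> + \<omega> - \<psi>"] cos_minus[of "\<theta> - \<omega> + \<phi>"] 
      unfolding polar by (simp add: algebra_simps inner_commute)
    from norm_two_directions[OF this] show ?thesis by (simp add: algebra_simps)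
  qed
  have ge_diff: "\<bar>P - Q\<bar> \<le> s" if "s \<ge> 0" "s\<^sup>2 = P\<^sup>2 + Q\<^sup>2 + 2 * P * Q * cos t" for s t
  proof (rule power2_le_imp_le)
    have "P * Q * (-1) \<le> P * Q * cos t" using PQ by (intro mult_left_mono) auto
    then show "\<bar>P - Q\<bar>\<^sup>2 \<le> s\<^sup>2" using that(2) by (simp add: power2_diff)
  qed (use that in simp)
  have sum_le: "h * (P + Q) \<le> r"
  proof -
    \<comment> \<open>the direction of largest stretching\<close>
    define \<theta> where "\<theta> = (\<psi> - \<phi>) / 2"
    have "2 * \<theta> + \<phi> - \<psi> = 0" by (simp add: \<theta>_def field_simps)
    then have "(norm (T (dir \<theta>)))\<^sup>2 = (P + Q)\<^sup>2"
      unfolding normT by (simp add: power2_sum)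
    then have "norm (T (dir \<theta>)) = P + Q" using PQ by (simp add: power2_eq_iff_nonneg)
    moreover have "h *\<^sub>R dir \<theta> \<in> capped_disc h B"
      using cball_subset_capped_disc[OF h1, of B] h by auto
    then have "T (h *\<^sub>R dir \<theta>) \<in> (*\<^sub>R) r ` capped_disc h A" using sub(2) by blast
    then obtain k where k: "k \<in> capped_disc h A" "T (h *\<^sub>R dir \<theta>) = r *\<^sub>R k" by blast
    have "norm k \<le> 1" using k(1) by (simp add: capped_disc_def)
    then have "norm (T (h *\<^sub>R dir \<theta>)) \<le> r" unfolding k(2) using r by simp
    ultimately show ?thesis using h T by (simp add: linear_cmul)
  qed
  have diff_ge: "h \<le> \<bar>P - Q\<bar>"
  proof -
    \<comment> \<open>the direction in which the adjoint stretches least\<close>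
    define \<omega> where "\<omega> = (pi + \<phi> + \<psi>) / 2"
    have "(norm (T' (dir \<omega>)))\<^sup>2 = (P - Q)\<^sup>2"
      unfolding normT' by (simp add: \<omega>_def power2_diff field_simps)
    then have n: "norm (T' (dir \<omega>)) = \<bar>P - Q\<bar>"
      by (metis abs_norm_cancel power2_eq_iff abs_minus_cancel)
    have "h *\<^sub>R dir \<omega> \<in> capped_disc h A"
      using cball_subset_capped_disc[OF h1, of A] h by auto
    then obtain z where z: "z \<in> capped_disc h B" "h *\<^sub>R dir \<omega> = T z" using sub(1) by blast
    have "h = (h *\<^sub>R dir \<omega>) \<bullet> dir \<omega>" by (simp add: inner_dir)
    also have "\<dots> = z \<bullet> T' (dir \<omega>)" unfolding z(2) adj ..
    also have "\<dots> \<le> norm z * norm (T' (dir \<omega>))" by (rule norm_cauchy_schwarz)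
    also have "\<dots> \<le> 1 * norm (T' (dir \<omega>))"
      using z(1) by (intro mult_right_mono) (auto simp: capped_disc_def)
    finally show ?thesis using n by simp
  qed
  have key: "h^4 * (P + Q) \<le> \<bar>P - Q\<bar>"
  proof -
    have "h^4 * (P + Q) = h^3 * (h * (P + Q))" by (simp add: power4_eq_xxxx power3_eq_cube)
    also have "\<dots> \<le> h^3 * r" using sum_le h by (intro mult_left_mono) auto
    also have "\<dots> = h * (r * h\<^sup>2)" by (simp add: power3_eq_cube power2_eq_square)
    also have "\<dots> \<le> h * 1" using rh h by (intro mult_left_mono) auto
    finally show ?thesis using diff_ge by simp
  qed
  have pairing: "\<bar>T (dir \<theta>) \<bullet> dir \<omega>\<bar> \<le> h * \<bar>P - Q\<bar>"
    if "P > Q \<Longrightarrow> \<bar>cos (\<theta> - \<omega> + \<phi>)\<bar> \<le> cos (3 * x)" "P \<le> Q \<Longrightarrow> \<bar>cos (\<theta> + \<omega> - \<psi>)\<bar> \<le> cos (3 * x)" for \<theta> \<omega>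
    unfolding polar using that unfolding cos3
    by (intro two_term_bound h(2) h1 PQ key) auto
  define c where "c = sqrt (P\<^sup>2 + Q\<^sup>2)"
  have cpos: "norm (T' (dir \<omega>)) \<ge> c" if "cos (2 * \<omega> - \<phi> - \<psi>) \<ge> 0" for \<omega>
    unfolding c_def using that PQ by (intro real_le_lsqrt) (auto simp: normT')
  have cneg: "norm (T (dir \<theta>)) \<le> c" if "cos (2 * \<theta> + \<phi> - \<psi>) \<le> 0" for \<theta>
    unfolding c_def using that PQ by (intro real_le_rsqrt) (auto simp: normT mult_nonneg_nonpos)
  have PQne: "\<bar>P - Q\<bar> > 0" using diff_ge h by linarith
  \<comment> \<open>A chord of the second body, in a direction that \<open>T\<close> stretches by at most \<open>c\<close>, is sent to an arc of the first body.\<close>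
  have "1 \<le> h * c"
  proof -
    define \<epsilon> \<phi>' where "\<epsilon> = (if P > Q then 1 else -1 :: real)" and "\<phi>' = (if P > Q then - \<phi> else \<psi>)"
    have "\<epsilon> \<in> {1,-1}" by (simp add: \<epsilon>_def)
    then obtain \<theta> where \<theta>: "\<theta> \<in> B" "cos (2 * \<theta> + (\<phi> - \<psi> + pi)) \<ge> 0"
      "\<And>\<omega>. \<omega> \<in> A \<Longrightarrow> \<bar>cos (\<theta> - \<epsilon> * \<omega> - \<phi>')\<bar> \<le> cos (3 * x)"
      using AB(2) unfolding spread_def by blast
    have flip: "2 * \<theta> + (\<phi> - \<psi> + pi) = (2 * \<theta> + \<phi> - \<psi>) + pi" by simp
    have le: "norm (T (dir \<theta>)) \<le> c"
      using cneg[of \<theta>] \<theta>(2) unfolding flip cos_periodic_pi by simp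
    define m where "m = norm (T (dir \<theta>))"
    have m: "\<bar>P - Q\<bar> \<le> m" unfolding m_def by (rule ge_diff[OF norm_ge_zero normT])
    then have m0: "m > 0" using PQne by linarith
    have "(1/m) *\<^sub>R T (dir \<theta>) \<in> capped_disc h A"
    proof -
      have "\<bar>((1/m) *\<^sub>R T (dir \<theta>)) \<bullet> dir \<omega>\<bar> \<le> h" if "\<omega> \<in> A" for \<omega>
      proof -
        have "\<bar>T (dir \<theta>) \<bullet> dir \<omega>\<bar> \<le> h * \<bar>P - Q\<bar>"
          using \<theta>(3)[OF that] by (intro pairing) (simp_all add: \<epsilon>_def \<phi>'_def)
        also have "\<dots> \<le> h * m" using m h by (intro mult_left_mono) auto
        finally show ?thesis using m0 by (simp add: abs_mult field_simps)
      qed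
      then show ?thesis using m0 by (simp add: capped_disc_def m_def)
    qed
    then obtain z where z: "z \<in> capped_disc h B" "(1/m) *\<^sub>R T (dir \<theta>) = T z" using sub(1) by blast
    have "z = (1/m) *\<^sub>R dir \<theta>" using z(2) T by (metis linear_cmul injD)
    then have "\<bar>(1/m) * (dir \<theta> \<bullet> dir \<theta>)\<bar> \<le> h" using z(1) \<theta>(1) by (auto simp: capped_disc_def)
    then have "1 / m \<le> h" using m0 by (simp add: inner_dir)
    then have "1 \<le> h * m" using m0 by (simp add: field_simps)
    also have "\<dots> \<le> h * c" using le h by (intro mult_left_mono) (auto simp: m_def)
    finally show ?thesis .
  qed
  \<comment> \<open>Dually, a chord of the first body is pulled back by the adjoint to an arc of the second.\<close>
  moreover have "c \<le> h * r"
  proof -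
    define \<epsilon> \<phi>' where "\<epsilon> = (if P > Q then 1 else -1 :: real)" and "\<phi>' = (if P > Q then \<phi> else \<psi>)"
    have "\<epsilon> \<in> {1,-1}" by (simp add: \<epsilon>_def)
    then obtain \<omega> where \<omega>: "\<omega> \<in> A" "cos (2 * \<omega> + (- \<phi> - \<psi>)) \<ge> 0"
      "\<And>\<theta>. \<theta> \<in> B \<Longrightarrow> \<bar>cos (\<omega> - \<epsilon> * \<theta> - \<phi>')\<bar> \<le> cos (3 * x)"
      using AB(1) unfolding spread_def by blast
    have ge: "c \<le> norm (T' (dir \<omega>))" using cpos[of \<omega>] \<omega>(2) by (simp add: algebra_simps)
    define m where "m = norm (T' (dir \<omega>))"
    have m: "\<bar>P - Q\<bar> \<le> m" unfolding m_def by (rule ge_diff[OF norm_ge_zero normT'])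
    then have m0: "m > 0" using PQne by linarith
    have "(1/m) *\<^sub>R T' (dir \<omega>) \<in> capped_disc h B"
    proof -
      have "\<bar>((1/m) *\<^sub>R T' (dir \<omega>)) \<bullet> dir \<theta>\<bar> \<le> h" if "\<theta> \<in> B" for \<theta>
      proof -
        have "\<bar>T (dir \<theta>) \<bullet> dir \<omega>\<bar> \<le> h * \<bar>P - Q\<bar>"
          using \<omega>(3)[OF that] cos_minus[of "\<theta> - \<omega> + \<phi>"]
          by (intro pairing) (simp_all add: \<epsilon>_def \<phi>'_def algebra_simps)
        also have "\<dots> \<le> h * m" using m h by (intro mult_left_mono) auto
        finally have "\<bar>dir \<theta> \<bullet> T' (dir \<omega>)\<bar> \<le> h * m" unfolding adj .
        then show ?thesis using m0 by (simp add: abs_mult field_simps inner_commute)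
      qed
      then show ?thesis using m0 by (simp add: capped_disc_def m_def)
    qed
    then have "T ((1/m) *\<^sub>R T' (dir \<omega>)) \<in> (*\<^sub>R) r ` capped_disc h A" using sub(2) by blast
    then obtain k where k: "k \<in> capped_disc h A" "T ((1/m) *\<^sub>R T' (dir \<omega>)) = r *\<^sub>R k" by blast
    have "m = (1/m) * (T' (dir \<omega>) \<bullet> T' (dir \<omega>))"
      using m0 by (simp add: m_def power2_norm_eq_inner[symmetric] power2_eq_square)
    also have "\<dots> = T ((1/m) *\<^sub>R T' (dir \<omega>)) \<bullet> dir \<omega>" using adj[of "(1/m) *\<^sub>R T' (dir \<omega>)" "dir \<omega>"] by simp
    also have "\<dots> = r * (k \<bullet> dir \<omega>)" unfolding k(2) by simp
    also have "\<dots> \<le> r * h" using k(1) \<omega>(1) r by (intro mult_left_mono) (auto simp: capped_disc_def abs_le_iff)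
    finally show ?thesis using ge by (simp add: m_def mult.commute)
  qed
  ultimately have "1 \<le> h * (h * r)" using mult_left_mono[of c "h * r" h] h by linarith
  then show False using rh by (simp add: power2_eq_square mult_ac)
qed

section \<open>Equilateral sets of capped discs\<close>

text \<open>
  Adding multiples of \<open>pi / 2\<close> to \<open>\<alpha>\<close> runs through all four sign
  patterns of cosine and sine; the pattern wanted is cosine nonnegative and sine nonpositive.
\<close>
lemma exists_quadrant:
  "\<exists>q<4::nat. \<forall>\<theta>. real q * (pi/4) \<le> \<theta> \<and> \<theta> \<le> (real q + 1) * (pi/4) \<longrightarrow> cos (2 * \<theta> + \<alpha>) \<ge> 0"
proof -
  have main: "\<forall>\<theta>. real q * (pi/4) \<le> \<theta> \<and> \<theta> \<le> (real q + 1) * (pi/4) \<longrightarrow> cos (2 * \<theta> + \<alpha>) \<ge> 0"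
    if "cos (\<alpha> + real q * (pi/2)) \<ge> 0" "sin (\<alpha> + real q * (pi/2)) \<le> 0" for q :: nat
  proof (intro allI impI)
    fix \<theta> assume \<theta>: "real q * (pi/4) \<le> \<theta> \<and> \<theta> \<le> (real q + 1) * (pi/4)"
    define t where "t = 2 * \<theta> - real q * (pi/2)"
    have t: "0 \<le> t" "t \<le> pi/2" using \<theta> by (auto simp: t_def field_simps)
    have "2 * \<theta> + \<alpha> = t + (\<alpha> + real q * (pi/2))" by (simp add: t_def)
    moreover have "cos t \<ge> 0" "sin t \<ge> 0" using t by (auto intro!: cos_ge_zero sin_ge_zero)
    then have "0 \<le> cos t * cos (\<alpha> + real q * (pi/2))" "sin t * sin (\<alpha> + real q * (pi/2)) \<le> 0"
      using that by (auto intro: mult_nonneg_nonneg mult_nonneg_nonpos)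
    ultimately show "cos (2 * \<theta> + \<alpha>) \<ge> 0"
      by (simp only: cos_add[of t])
  qed
  have "cos (\<alpha> + real 0 * (pi/2)) = cos \<alpha>" "sin (\<alpha> + real 0 * (pi/2)) = sin \<alpha>"
    "cos (\<alpha> + real 1 * (pi/2)) = - sin \<alpha>" "sin (\<alpha> + real 1 * (pi/2)) = cos \<alpha>"
    "cos (\<alpha> + real 2 * (pi/2)) = - cos \<alpha>" "sin (\<alpha> + real 2 * (pi/2)) = - sin \<alpha>"
    by (simp_all add: cos_add sin_add)
  moreover have "cos (\<alpha> + real 3 * (pi/2)) = sin \<alpha>" "sin (\<alpha> + real 3 * (pi/2)) = - cos \<alpha>"
  proof -
    have "\<alpha> + real 3 * (pi/2) = \<alpha> + pi/2 + pi" by simp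
    then show "cos (\<alpha> + real 3 * (pi/2)) = sin \<alpha>" "sin (\<alpha> + real 3 * (pi/2)) = - cos \<alpha>"
      by (simp_all only: cos_periodic_pi sin_periodic_pi cos_add sin_add) simp_all
  qed
  ultimately have "\<exists>q\<in>{0,1,2,3::nat}. cos (\<alpha> + real q * (pi/2)) \<ge> 0 \<and> sin (\<alpha> + real q * (pi/2)) \<le> 0"
    by (simp only: bex_simps) linarith
  then obtain q :: nat where "q \<in> {0,1,2,3}" "cos (\<alpha> + real q * (pi/2)) \<ge> 0" "sin (\<alpha> + real q * (pi/2)) \<le> 0"
    by blast
  then show ?thesis using main[of q] by (intro exI[of _ q]) auto
qed

definition code_angles :: "nat \<Rightarrow> nat set \<Rightarrow> real set" where
  "code_angles g X = (\<lambda>k. chord_pos X k * (pi / (36 * real g))) ` {..<4*g}"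

text \<open>
  The condition \<open>18 * g \<le> N\<close> makes one step of the cyclic grid at least twice the
  half-width \<open>x\<close> of a cap. Rounding the rotation angle to the grid costs half a step, and a
  pair that does not hit is at least two steps apart, which leaves the required \<open>3 * x\<close>.
  Directions are counted modulo \<open>pi\<close>, as chords come in opposite pairs.
\<close>
lemma spread_code_angles:
  assumes av: "avoids g X Y" and g: "g > 0" "18 * g \<le> N"
  shows "spread (pi / (4 * real N)) (code_angles g X) (code_angles g Y)"
  unfolding spread_def
proof (intro ballI allI)
  fix \<epsilon> \<phi> \<alpha> :: real assume \<epsilon>: "\<epsilon> \<in> {1,-1}"
  define \<delta> where "\<delta> = pi / (36 * real g)"
  have \<delta>: "\<delta> > 0" "36 * real g * \<delta> = pi" using g by (auto simp: \<delta>_def)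
  define \<epsilon>' :: int where "\<epsilon>' = (if \<epsilon> = 1 then 1 else -1)"
  have \<epsilon>': "\<epsilon>' \<in> {1,-1}" "\<epsilon> = \<epsilon>'" using \<epsilon> by (auto simp: \<epsilon>'_def)
  obtain w and s :: int where s: "\<phi> = w * \<delta>" "\<bar>w - s\<bar> \<le> 1/2"
  proof
    show "\<phi> = (\<phi> / \<delta>) * \<delta>" using \<delta>(1) by simp
    show "\<bar>\<phi> / \<delta> - round (\<phi> / \<delta>)\<bar> \<le> 1/2"
      using of_int_round_abs_le[of "\<phi> / \<delta>"] by (simp add: abs_minus_commute)
  qed
  obtain q :: nat where q: "q < 4"
    "\<And>\<theta>. real q * (pi/4) \<le> \<theta> \<Longrightarrow> \<theta> \<le> (real q + 1) * (pi/4) \<Longrightarrow> cos (2 * \<theta> + \<alpha>) \<ge> 0"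
    using exists_quadrant by blast
  obtain k where k: "k \<in> {q*g..<(q+1)*g}" and
    nohit: "\<And>l. l < 4*g \<Longrightarrow> \<not> hits (36*g) \<epsilon>' s (chord_pos X k) (chord_pos Y l)"
    using av q(1) \<epsilon>'(1) unfolding avoids_def by blast
  define \<theta> where "\<theta> = chord_pos X k * \<delta>"
  have "(q+1)*g \<le> 4*g" using q(1) by (intro mult_right_mono) auto
  then have "k < 4*g" using k less_le_trans[of k "(q+1)*g" "4*g"] by simp
  then have mem: "\<theta> \<in> code_angles g X" by (auto simp: code_angles_def \<theta>_def \<delta>_def)
  have "real_of_int (chord_pos X k) \<ge> 9 * real k" "real_of_int (chord_pos X k) \<le> 9 * real k + 3"
    by (auto simp: chord_pos_def)
  moreover have "real q * real g \<le> real k" "real k + 1 \<le> (real q + 1) * real g"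
  proof -
    have "q * g \<le> k" "k + 1 \<le> (q + 1) * g" using k by simp_all
    then have "real (q * g) \<le> real k" "real (k + 1) \<le> real ((q + 1) * g)"
      by (simp_all only: of_nat_le_iff)
    then show "real q * real g \<le> real k" "real k + 1 \<le> (real q + 1) * real g"
      by (simp_all add: algebra_simps)
  qed
  ultimately have pos: "9 * (real q * real g) \<le> chord_pos X k" "chord_pos X k \<le> 9 * ((real q + 1) * real g)"
    by linarith+
  have pi4: "pi / 4 = 9 * real g * \<delta>" using \<delta> by simp
  have "real q * (pi/4) \<le> \<theta>" "\<theta> \<le> (real q + 1) * (pi/4)"
    using mult_right_mono[OF pos(1), of \<delta>] mult_right_mono[OF pos(2), of \<delta>] \<delta>(1)
    unfolding pi4 \<theta>_def by (simp_all add: mult_ac)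
  then have window: "cos (2 * \<theta> + \<alpha>) \<ge> 0" by (rule q(2))
  have "\<bar>cos (\<theta> - \<epsilon> * \<omega> - \<phi>)\<bar> \<le> cos (3 * (pi / (4 * real N)))" if \<omega>: "\<omega> \<in> code_angles g Y" for \<omega>
  proof (rule abs_cos_le)
    obtain l where l: "l < 4*g" "\<omega> = chord_pos Y l * \<delta>"
      using \<omega> by (auto simp: code_angles_def \<delta>_def)
    fix z :: int
    define a where "a = chord_pos X k - \<epsilon>' * chord_pos Y l - s - z * int (36*g)"
    have "\<not> \<bar>a\<bar> \<le> 1" using nohit[OF l(1)] unfolding hits_def a_def by blast
    then have a: "\<bar>real_of_int a\<bar> \<ge> 2" by linarith
    have zpi: "z * pi = z * (36 * real g * \<delta>)" unfolding \<delta>(2) ..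
    have "\<theta> - \<epsilon> * \<omega> - \<phi> - z * pi = (a - (w - s)) * \<delta>"
      unfolding \<theta>_def l(2) \<epsilon>'(2) a_def zpi s(1) by (simp add: algebra_simps)
    moreover have "\<bar>(a - (w - s)) * \<delta>\<bar> \<ge> 3/2 * \<delta>"
    proof -
      have "3/2 \<le> \<bar>a - (w - s)\<bar>" using a s(2) by linarith
      then show ?thesis unfolding abs_mult using \<delta>(1) by (intro mult_mono) auto
    qed
    moreover have "3 * (pi / (4 * real N)) \<le> 3/2 * \<delta>"
    proof -
      have "2 * real N \<ge> 36 * real g" using g by linarith
      then have "pi / (2 * real N) \<le> \<delta>" unfolding \<delta>_def using g by (intro divide_left_mono) auto
      then show ?thesis by (simp add: field_simps)
    qed
    ultimately show "3 * (pi / (4 * real N)) \<le> \<bar>\<theta> - \<epsilon> * \<omega> - \<phi> - z * pi\<bar>" by simp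
  qed simp
  then show "\<exists>\<theta>\<in>code_angles g X. 0 \<le> cos (2 * \<theta> + \<alpha>) \<and>
      (\<forall>\<omega>\<in>code_angles g Y. \<bar>cos (\<theta> - \<epsilon> * \<omega> - \<phi>)\<bar> \<le> cos (3 * (pi / (4 * real N))))"
    using mem window by blast
qed

text \<open>
  The second part holds since linearly equivalent bodies would admit \<open>r = 1\<close> in the lower
  bound.
\<close>
lemma spread_capped_discs_dist:
  assumes h: "h = cos x" "9/10 \<le> h" "h < 1" and AB: "spread x A B" "spread x B A"
  shows "BM_dist (capped_disc h A) (capped_disc h B) = 1 / h\<^sup>2"
    and "(capped_disc h A, capped_disc h B) \<notin> lin_equiv"
proof -
  have lower: "1 / h\<^sup>2 \<le> r" if "r > 0" "linear T" "bij T" "capped_disc h A \<subseteq> T ` capped_disc h B"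
    "T ` capped_disc h B \<subseteq> (*\<^sub>R) r ` capped_disc h A" for r T
    using spread_distance_ge[OF h(1,2) AB that(2) bij_is_inj[OF that(3)] that(1,4,5)] .
  show "BM_dist (capped_disc h A) (capped_disc h B) = 1 / h\<^sup>2"
    unfolding BM_dist_def
  proof (rule cInf_eq_minimum)
    have "0 < 1 / h\<^sup>2" using h(2) by simp
    moreover have "\<exists>T. linear T \<and> bij T \<and> capped_disc h A \<subseteq> T ` capped_disc h B \<and>
        T ` capped_disc h B \<subseteq> (*\<^sub>R) (1/h\<^sup>2) ` capped_disc h A"
      using h(2,3) by (intro capped_discs_within) auto
    ultimately show "1 / h\<^sup>2 \<in> {r. 0 < r \<and> (\<exists>T. linear T \<and> bij T \<and> capped_disc h A \<subseteq> T ` capped_disc h B \<and>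
        T ` capped_disc h B \<subseteq> (*\<^sub>R) r ` capped_disc h A)}"
      by (intro CollectI conjI)
  next
    fix r assume "r \<in> {r. 0 < r \<and> (\<exists>T. linear T \<and> bij T \<and> capped_disc h A \<subseteq> T ` capped_disc h B \<and>
        T ` capped_disc h B \<subseteq> (*\<^sub>R) r ` capped_disc h A)}"
    then show "1 / h\<^sup>2 \<le> r" using lower[of r] by (elim CollectE conjE exE)
  qed
  show "(capped_disc h A, capped_disc h B) \<notin> lin_equiv"
  proof
    assume "(capped_disc h A, capped_disc h B) \<in> lin_equiv"
    then obtain T where T: "linear T" "bij T" "capped_disc h B = T ` capped_disc h A"
      by (auto simp: lin_equiv_def)
    have "inv T ` capped_disc h B = capped_disc h A"
      unfolding T(3) by (rule linear_bij_inv(3)[OF T(1,2)])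
    then have "1 / h\<^sup>2 \<le> 1"
      by (intro lower[of 1 "inv T"] linear_bij_inv[OF T(1,2)]) auto
    moreover have "h\<^sup>2 < 1" using h by (simp add: power_less_one_iff)
    ultimately show False using h(2) by (simp add: field_simps)
  qed
qed

lemma exists_equilateral_set:
  assumes h: "h = cos (pi / (4 * real N))" "9/10 \<le> h" "h < 1" and g: "g > 0" "18 * g \<le> N"
  shows "\<exists>S. BM_equilateral (1 / h\<^sup>2) S \<and> 2 ^ g \<le> card S * (577 * g)"
proof -
  obtain F where "F \<subseteq> Pow {..<4*g} \<and> 2 ^ g \<le> card F * (577 * g) \<and>
      (\<forall>X\<in>F. \<forall>Y\<in>F. X \<noteq> Y \<longrightarrow> avoids g X Y)"
    using exists_avoiding_family[OF g(1)] by (rule exE)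
  then have F: "2 ^ g \<le> card F * (577 * g)"
    "X \<in> F \<Longrightarrow> Y \<in> F \<Longrightarrow> X \<noteq> Y \<Longrightarrow> avoids g X Y" for X Y
    by simp_all
  define body where "body = (\<lambda>X. capped_disc h (code_angles g X))"
  define cls where "cls = (\<lambda>X. lin_equiv `` {body X})"
  have body: "sym_convex_body (body X)" for X
    unfolding body_def using h by (intro sym_convex_body_capped_disc) auto
  have cls: "cls X \<in> BM_compactum" "body X \<in> cls X" for X
  proof -
    have "body X \<in> {K. sym_convex_body K}" using body by simp
    then show "cls X \<in> BM_compactum" unfolding cls_def BM_compactum_def by (rule quotientI)
    show "body X \<in> cls X"
      unfolding cls_def using body by (intro equiv_class_self[OF equiv_lin_equiv]) simp
  qed
  have dist: "BM_dist (body X) (body Y) = 1 / h\<^sup>2" "(body X, body Y) \<notin> lin_equiv"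
    if "X \<in> F" "Y \<in> F" "X \<noteq> Y" for X Y
  proof -
    have "avoids g X Y" "avoids g Y X" using F(2) that by simp_all
    note sp = this[THEN spread_code_angles[OF _ g]]
    show "BM_dist (body X) (body Y) = 1 / h\<^sup>2"
      unfolding body_def by (rule spread_capped_discs_dist(1)[OF h sp])
    show "(body X, body Y) \<notin> lin_equiv"
      unfolding body_def by (rule spread_capped_discs_dist(2)[OF h sp])
  qed
  have "inj_on cls F"
  proof (rule inj_onI, rule ccontr)
    fix X Y assume XY: "X \<in> F" "Y \<in> F" "cls X = cls Y" "X \<noteq> Y"
    have "body Y \<in> cls X" using cls(2)[of Y] XY(3) by simp
    then have "(body X, body Y) \<in> lin_equiv" by (simp add: cls_def)
    then show False using dist(2)[OF XY(1,2,4)] by blast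
  qed
  then have "card (cls ` F) = card F" by (rule card_image)
  moreover have "BM_equilateral (1 / h\<^sup>2) (cls ` F)"
    unfolding BM_equilateral_def
  proof (intro conjI ballI impI)
    show "cls ` F \<subseteq> BM_compactum" using cls by blast
    fix C D assume "C \<in> cls ` F" "D \<in> cls ` F" "C \<noteq> D"
    then obtain X Y where XY: "X \<in> F" "Y \<in> F" "X \<noteq> Y" "C = cls X" "D = cls Y" by blast
    have "BM_class_dist (cls X) (cls Y) = BM_dist (body X) (body Y)"
      by (rule BM_class_dist_eq[OF cls(1) cls(1) cls(2) cls(2)])
    then show "BM_class_dist C D = 1 / h\<^sup>2" unfolding XY(4,5) dist(1)[OF XY(1-3)] .
  qed
  ultimately show ?thesis using F(1) by (intro exI[of _ "cls ` F"] conjI) (simp_all only:)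
qed

section \<open>The maximal cardinalities\<close>

lemma is_max_card_exists:
  assumes "P S0" and bound: "\<And>S. P S \<Longrightarrow> finite S \<and> card S \<le> b"
  shows "\<exists>m. is_max_card P m \<and> card S0 \<le> m \<and> m \<le> b"
proof -
  let ?C = "card ` Collect P"
  have fin: "finite ?C" using bound by (intro finite_subset[of ?C "{..b}"]) auto
  have ne: "?C \<noteq> {}" using assms(1) by blast
  have "Max ?C \<in> ?C" using Max_in[OF fin ne] .
  then obtain S where S: "P S" "card S = Max ?C" by auto
  have "is_max_card P (Max ?C)"
    unfolding is_max_card_def using S bound Max_ge[OF fin] by blast
  moreover have "card S0 \<le> Max ?C" using assms(1) by (intro Max_ge[OF fin]) blast
  moreover have "Max ?C \<le> b" using S bound by metis
  ultimately show ?thesis by blast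
qed

text \<open>
  Half of the exponent absorbs the factor lost to the union bound in
  \<open>exists_avoiding_family\<close>.
\<close>
lemma linear_le_power:
  assumes "g \<ge> 40" shows "577 * g \<le> 2 ^ (g div 2)"
proof -
  have "577 * (2 * m + 1) \<le> 2 ^ m" if "m \<ge> 20" for m :: nat
    using that by (induction m rule: dec_induct) auto
  then have "577 * (2 * (g div 2) + 1) \<le> 2 ^ (g div 2)" using assms by simp
  moreover have "577 * g \<le> 577 * (2 * (g div 2) + 1)" by simp
  ultimately show ?thesis by (meson le_trans)
qed

text \<open>
  The lower bound for the sine comes from the mean value theorem, with the derivative at least
  \<open>9/10\<close>.
\<close>
lemma angle_bounds:
  assumes "N \<ge> 3"
  defines "x \<equiv> pi / (4 * real N)"
  shows "9/10 \<le> cos x" "cos x < 1" "1 / (2 * real N) \<le> sin x" "sin x \<le> 4 / (5 * real N)"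
proof -
  have x0: "x > 0" using assms by simp
  have xN: "x \<le> 4 / (5 * real N)" using assms pi_less_4 pi_approx by (simp add: x_def field_simps)
  also have "\<dots> \<le> 4 / (5 * 3)" using assms by (intro divide_left_mono) auto
  finally have x1: "x \<le> 4/15" by simp
  show "sin x \<le> 4 / (5 * real N)" using sin_x_le_x[of x] x0 xN by linarith
  have "cos x = 1 - 2 * (sin (x/2))\<^sup>2" using cos_double_sin[of "x/2"] by simp
  moreover have "0 \<le> sin (x/2)" "sin (x/2) \<le> 2/15"
    using sin_x_le_x[of "x/2"] x0 x1 pi_gt3 by (auto intro!: sin_ge_zero)
  then have "(sin (x/2))\<^sup>2 \<le> (2/15)\<^sup>2" by (intro power_mono) auto
  ultimately show c: "9/10 \<le> cos x" by (simp add: power_divide)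
  have "cos x < cos 0" using x0 x1 pi_gt3 by (intro cos_monotone_0_pi) auto
  then show "cos x < 1" by simp
  obtain z where z: "0 < z" "z < x" "sin x - sin 0 = (x - 0) * cos z"
    using MVT2[of 0 x sin cos] x0 DERIV_sin by blast
  have "cos x \<le> cos z" using z x1 pi_gt3 by (intro cos_monotone_0_pi_le) auto
  then have "x * (9/10) \<le> sin x" using z(3) c x0 by (simp add: mult_left_mono)
  moreover have "1 / (2 * real N) \<le> x * (9/10)" using assms pi_gt3 by (simp add: x_def field_simps)
  ultimately show "1 / (2 * real N) \<le> sin x" by linarith
qed

theorem mainTheorem2:
  "\<exists>(c1::real) (c2::real) (N0::nat). 0 < c1 \<and> c1 < c2 \<and> 2 \<le> N0 \<and>
     (\<forall>N\<ge>N0. \<exists>m s :: nat.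
        is_max_card (BM_equilateral ((d_N N)\<^sup>2)) m \<and>
        is_max_card (BM_separated ((d_N N)\<^sup>2)) s \<and>
        real m \<in> {exp (c1 * sqrt (inverse (eps_N N))) .. exp (c2 * sqrt (inverse (eps_N N)))} \<and>
        real s \<in> {exp (c1 * sqrt (inverse (eps_N N))) .. exp (c2 * sqrt (inverse (eps_N N)))})"
proof (rule exI[of _ "1/288"], rule exI[of _ 3160], rule exI[of _ 720], intro conjI allI impI)
  show "0 < (1/288::real)" "(1/288::real) < 3160" "2 \<le> (720::nat)" by simp_all
next
  fix N :: nat assume N: "N \<ge> 720"
  define x where "x = pi / (4 * real N)"
  define h where "h = cos x"
  define R where "R = sqrt (inverse (eps_N N))"
  have N3: "N \<ge> 3" using N by simp
  note b = angle_bounds[OF N3, folded x_def, folded h_def]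
  have "0 < 1 / (2 * real N)" using N by simp
  then have s0: "sin x > 0" using b(3) by linarith
  have d: "(d_N N)\<^sup>2 = 1 / h\<^sup>2" by (simp add: d_N_def h_def x_def power_divide)
  have sin2: "(sin x)\<^sup>2 = 1 - h\<^sup>2" by (simp add: h_def sin_squared_eq)
  have "eps_N N = (sin x / h)\<^sup>2"
    unfolding eps_N_def d power_divide sin2 using b(1) by (simp add: field_simps)
  then have R: "R = h / sin x"
    using s0 b(1) by (simp add: R_def real_sqrt_divide flip: power_inverse)
  have R_ge: "real N \<le> R"
  proof -
    have "real N * sin x \<le> real N * (4 / (5 * real N))" using b(4) by (intro mult_left_mono) auto
    also have "\<dots> \<le> h" using b(1) N by simp
    finally show ?thesis using s0 by (simp add: R field_simps)
  qed
  have R_le: "R \<le> 2 * real N"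
  proof -
    have "h \<le> 2 * real N * (1 / (2 * real N))" using b(2) N by simp
    also have "\<dots> \<le> 2 * real N * sin x" using b(3) by (intro mult_left_mono) auto
    finally show ?thesis using s0 by (simp add: R field_simps)
  qed
  define g where "g = N div 18"
  have g: "g \<ge> 40" "18 * g \<le> N" "N < 18 * g + 18" using N by (auto simp: g_def)
  obtain S0 where S0: "BM_equilateral (1 / h\<^sup>2) S0" "2 ^ g \<le> card S0 * (577 * g)"
    using exists_equilateral_set[of h N g] b g unfolding h_def x_def by auto
  have sep: "BM_separated (1 / h\<^sup>2) S" if "BM_equilateral (1 / h\<^sup>2) S" for S
    using that by (simp add: BM_separated_def BM_equilateral_def)
  \<comment> \<open>The resolution \<open>10 * N\<close> puts the distance of two bodies with equal codes, at most \<open>1 + 12 / (10 * N)\<^sup>2\<close>, below \<open>1 + (sin x)\<^sup>2\<close>.\<close>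
  have close: "(1 + 4 / (real (10 * N))\<^sup>2)\<^sup>2 < 1 / h\<^sup>2"
  proof -
    define u where "u = 4 / (real (10 * N))\<^sup>2"
    have "2\<^sup>2 \<le> (real (10 * N))\<^sup>2" using N by (intro power_mono) auto
    then have u: "0 < u" "u \<le> 1" using N by (auto simp: u_def)
    have "(1 + u)\<^sup>2 \<le> 1 + 3 * u" using u mult_left_mono[of u 1 u] by (simp add: power2_eq_square algebra_simps)
    also have "3 * u < (1 / (2 * real N))\<^sup>2" using N by (simp add: u_def power_divide power_mult_distrib field_simps)
    also have "(1 / (2 * real N))\<^sup>2 \<le> (sin x)\<^sup>2" using b(3) by (intro power_mono) auto
    also have "1 + (sin x)\<^sup>2 \<le> 1 / h\<^sup>2"
    proof -
      have "(1 + (sin x)\<^sup>2) * h\<^sup>2 = 1 - (1 - h\<^sup>2)\<^sup>2" unfolding sin2 by algebra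
      then have "(1 + (sin x)\<^sup>2) * h\<^sup>2 \<le> 1" by simp
      then show ?thesis using b(1) by (simp add: pos_le_divide_eq)
    qed
    finally show ?thesis by (simp add: u_def)
  qed
  have bound: "finite S \<and> card S \<le> 2 ^ (316 * (10 * N))" if "BM_separated (1 / h\<^sup>2) S" for S
    using separated_card_bound[OF that _ close] N by simp
  obtain m where m: "is_max_card (BM_equilateral (1 / h\<^sup>2)) m" "card S0 \<le> m" "m \<le> 2 ^ (316 * (10 * N))"
    using is_max_card_exists[of "BM_equilateral (1 / h\<^sup>2)" S0] S0(1) bound sep by blast
  obtain s where s: "is_max_card (BM_separated (1 / h\<^sup>2)) s" "card S0 \<le> s" "s \<le> 2 ^ (316 * (10 * N))"
    using is_max_card_exists[of "BM_separated (1 / h\<^sup>2)" S0] S0(1) bound sep by blast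
  have two_le: "2 \<le> exp (1::real)" using exp_ge_add_one_self[of "1::real"] by simp
  have upper: "real k \<le> exp (3160 * R)" if "k \<le> 2 ^ (316 * (10 * N))" for k
  proof -
    have "real k \<le> real (2 ^ (316 * (10 * N)))" using that by (simp only: of_nat_le_iff)
    also have "\<dots> = 2 ^ (3160 * N)" by simp
    also have "\<dots> \<le> exp 1 ^ (3160 * N)" using two_le by (intro power_mono) auto
    also have "\<dots> = exp (3160 * real N)" by (simp flip: exp_of_nat_mult)
    also have "\<dots> \<le> exp (3160 * R)" using R_ge by simp
    finally show ?thesis .
  qed
  have lower: "exp (1/288 * R) \<le> real k" if "card S0 \<le> k" for k
  proof -
    define e where "e = g - g div 2"
    have "2 ^ e * 2 ^ (g div 2) = (2::nat) ^ g" by (simp add: e_def flip: power_add)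
    also have "\<dots> \<le> card S0 * (577 * g)" by (rule S0(2))
    also have "\<dots> \<le> card S0 * 2 ^ (g div 2)" by (intro mult_left_mono linear_le_power g) simp
    finally have "2 ^ e \<le> card S0" by simp
    then have e: "2 ^ e \<le> k" using that by linarith
    have "g \<le> 2 * e" by (simp add: e_def)
    then have "R \<le> 144 * real e" using R_le g(1,3) by linarith
    then have "exp (1/288 * R) \<le> exp (real e * (1/2))" by simp
    also have "\<dots> = exp (1/2) ^ e" by (rule exp_of_nat_mult)
    also have "\<dots> \<le> 2 ^ e"
    proof (rule power_mono)
      have "(exp (1/2::real))\<^sup>2 \<le> 2\<^sup>2" using exp_le by (simp flip: exp_double)
      then show "exp (1/2::real) \<le> 2" by (rule power2_le_imp_le) simp
    qed simp
    also have "\<dots> = real (2 ^ e)" by simp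
    also have "\<dots> \<le> real k" using e by (simp only: of_nat_le_iff)
    finally show ?thesis .
  qed
  show "\<exists>m s. is_max_card (BM_equilateral ((d_N N)\<^sup>2)) m \<and>
      is_max_card (BM_separated ((d_N N)\<^sup>2)) s \<and>
      real m \<in> {exp (1/288 * sqrt (inverse (eps_N N))) .. exp (3160 * sqrt (inverse (eps_N N)))} \<and>
      real s \<in> {exp (1/288 * sqrt (inverse (eps_N N))) .. exp (3160 * sqrt (inverse (eps_N N)))}"
    unfolding d R_def[symmetric] using m s upper lower by (intro exI[of _ m] exI[of _ s]) simp
qed

end
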